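(* Let $q,a$ be complex numbers with $0<|q|<1$, $a\neq 0$ and $a\notin\{q^m: m\in\mathbb{Z}\}$. Let $k$ be a positive integer, put $\kappa=2k+1$ and, for nonnegative integers $n_1,\dots,n_{k-1}$, $N_j=n_j+n_{j+1}+\cdots+n_{k-1}$. Then $$\sum_{n=0}^{\infty}\frac{(q;q)_{2n}\, q^n}{(a;q)_{n+1}(q/a;q)_n}\sum_{n_1,\dots,n_{k-1}=0}^{\infty}\frac{q^{N_1^2+\cdots+N_{k-1}^2+N_1+\cdots+N_{k-1}}}{(q;q)_{n-N_1}(q;q)_{n_1}\cdots(q;q)_{n_{k-1}}}$$ $$=\sum_{n=0}^{\infty} a^n q^{kn(n+1)}+\sum_{i=1}^{\kappa-1} (-1)^{i+1} a^i q^{\binom{i}{2}}\frac{(q^i,q^{\kappa-i},q^{\kappa};q^{\kappa})_{\infty}}{(q,a,q/a;q)_{\infty}}\sum_{n=0}^{\infty} a^{\kappa n}q^{kn(\kappa n+2i)}.$$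
   Context: Notation: $(x;q)_\infty=\prod_{j=0}^\infty(1-xq^j)$; $(x;q)_n=(x;q)_\infty/(xq^n;q)_\infty$ for all integers $n$ (so $(x;q)_n=\prod_{j=0}^{n-1}(1-xq^j)$ for $n\ge 0$), and $1/(q;q)_n=0$ for negative $n$; $(x_1,\dots,x_m;q)_n=(x_1;q)_n\cdots(x_m;q)_n$ (also for $n=\infty$). $\binom{i}{2}=i(i-1)/2$. For $k=1$ there are no summation variables $n_j$, $N_1=0$, and the inner sum is $1/(q;q)_n$. *)

theory Defs
  imports "HOL-Analysis.Analysis"
begin

definition qpoch_inf :: "complex \<Rightarrow> complex \<Rightarrow> complex" where
  "qpoch_inf x q = (\<Prod>j. 1 - x * q ^ j)"

text \<open>
  \<open>(x;q)\<^sub>n\<close> for an arbitrary integer \<open>n\<close>, as a quotient of infinite products. If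
  \<open>x * q powi n\<close> is a power \<open>q powi (- m)\<close> with \<open>m \<ge> 0\<close>, the denominator vanishes and
  the value is the convention \<open>x / 0 = 0\<close>; reciprocals at \<open>x = q\<close>, where this happens for
  negative \<open>n\<close>, therefore have their own definition \<open>recip_qpoch\<close> below.
\<close>
definition qpoch :: "complex \<Rightarrow> complex \<Rightarrow> int \<Rightarrow> complex" where
  "qpoch x q n = qpoch_inf x q / qpoch_inf (x * q powi n) q"

text \<open>\<open>(x\<^sub>1,\<dots>,x\<^sub>m;q)\<^sub>\<infinity>\<close>\<close>
definition qpochs_inf :: "complex list \<Rightarrow> complex \<Rightarrow> complex" where
  "qpochs_inf xs q = (\<Prod>x\<leftarrow>xs. qpoch_inf x q)"

text \<open>\<open>1/(q;q)\<^sub>n\<close>, with the convention that it is \<open>0\<close> for negative \<open>n\<close>\<close>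
definition recip_qpoch :: "complex \<Rightarrow> int \<Rightarrow> complex" where
  "recip_qpoch q n = (if n < 0 then 0 else 1 / qpoch q q n)"

text \<open>\<open>N\<^sub>j = n\<^sub>j + \<dots> + n\<^bsub>k-1\<^esub>\<close>; for \<open>k = 1\<close> this gives \<open>N\<^sub>1 = 0\<close>.\<close>
definition tail_sum :: "nat \<Rightarrow> (nat \<Rightarrow> nat) \<Rightarrow> nat \<Rightarrow> nat" where
  "tail_sum k \<nu> j = (\<Sum>i\<in>{j..<k}. \<nu> i)"

text \<open>
  The inner multisum. A tuple \<open>(n\<^sub>1,\<dots>,n\<^bsub>k-1\<^esub>)\<close> is an extensional function \<open>\<nu>\<close> on
  \<open>{1..<k}\<close>; for \<open>k = 1\<close> there is exactly one, and the sum is \<open>1/(q;q)\<^sub>n\<close>. Only the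
  finitely many tuples with \<open>N\<^sub>1 \<le> n\<close> contribute, so convergence is not an issue.
\<close>
definition inner_sum :: "nat \<Rightarrow> complex \<Rightarrow> nat \<Rightarrow> complex" where
  "inner_sum k q n =
     (\<Sum>\<^sub>\<infinity>\<nu>\<in>{1..<k} \<rightarrow>\<^sub>E (UNIV :: nat set).
        q ^ ((\<Sum>j\<in>{1..<k}. (tail_sum k \<nu> j)\<^sup>2) + (\<Sum>j\<in>{1..<k}. tail_sum k \<nu> j))
        * recip_qpoch q (int n - int (tail_sum k \<nu> 1))
        * (\<Prod>j\<in>{1..<k}. recip_qpoch q (int (\<nu> j))))"

end

theory Submission
  imports Defs
begin

text \<open>
  Write \<open>P n = (q;q)\<^sub>n\<close> and \<open>\<Theta> = (q,a,q/a;q)\<^sub>\<infinity>\<close>. Iterating Bailey's lemma from the unit Bailey pair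
  turns the inner multisum into the single sum \<open>\<Sum>L\<le>n. \<alpha> L / (P (n - L) * P (n + L + 1))\<close> with
  \<open>\<alpha> L = (-1)^L q^(kL(L+1) + L(L-1)/2) (1 - q^(2L+1))\<close>. After exchanging summations, one needs for
  each \<open>L\<close> the sum over \<open>n\<close> of \<open>q^n P(2n) / ((a;q)\<^bsub>n+1\<^esub> (q/a;q)\<^sub>n P(n-L) P(n+L+1))\<close>. This is an instance
  of Warnaar's product formula for partial theta functions: multiplied by \<open>\<Theta>\<close> it equals
  \<open>q^L / (1 - q^(2L+1))\<close> times \<open>\<Sum>d\<in>\<int>. (-1)^d q^(\<bar>d\<bar>(\<bar>d\<bar>+1)/2 + L\<bar>d\<bar>) a^d\<close>. To prove it, expand
  \<open>(aq^(n+1))\<^sub>\<infinity> (q^(n+1)/a)\<^sub>\<infinity>\<close> by Euler's identity and compare powers of \<open>a\<close>; each coefficient collapses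
  by the \<open>q\<close>-binomial theorem.

  Hence \<open>\<Theta>\<close> times the left-hand side is a signed sum over pairs \<open>(L, d)\<close> of the lattice terms
  \<open>f L d = (-1)^(L+d) q^(kL(L+1) + (L+d)(L+d+1)/2) a^d\<close>: the quadrant \<open>L, d \<ge> 0\<close> minus the quadrant
  \<open>L, d < 0\<close>. By the triple product, \<open>\<Theta> * (\<Sum>n. a^n q^(kn(n+1)))\<close> is minus the half plane \<open>L < 0\<close>.
  The difference is the half plane \<open>d \<ge> 0\<close>; there the sum over \<open>L\<close> for \<open>d = \<kappa> n + i\<close> is a triple
  product with base \<open>q^\<kappa>\<close>, which vanishes for \<open>i = 0\<close>.
\<close>

subsection \<open>Double series\<close>

text \<open>Source of absolute convergence for the double series below: the general term is bounded
  by a function of one index times a function of the other.\<close>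

lemma summable_on_dominated_product:
  fixes h :: "'a \<times> 'b \<Rightarrow> complex" and f :: "'a \<Rightarrow> real" and g :: "'b \<Rightarrow> real"
  assumes f: "f summable_on A" and g: "g summable_on B" and "S \<subseteq> A \<times> B"
    and le: "\<And>x y. (x, y) \<in> S \<Longrightarrow> norm (h (x, y)) \<le> f x * g y"
  shows "h summable_on S"
proof -
  have f': "(\<lambda>x. \<bar>f x\<bar>) summable_on A"
    using summable_on_iff_abs_summable_on_real[of f A] f by simp
  have g': "(\<lambda>x. \<bar>g x\<bar>) summable_on B"
    using summable_on_iff_abs_summable_on_real[of g B] g by simp
  have "(\<lambda>(x, y). \<bar>f x\<bar> * \<bar>g y\<bar>) summable_on A \<times> B"
  proof (rule summable_on_SigmaI)
    show "((\<lambda>y. case (x, y) of (x, y) \<Rightarrow> \<bar>f x\<bar> * \<bar>g y\<bar>) has_sum \<bar>f x\<bar> * infsum (\<lambda>y. \<bar>g y\<bar>) B) B" for x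
      using has_sum_cmult_right[OF has_sum_infsum[OF g']] by simp
    show "(\<lambda>x. \<bar>f x\<bar> * infsum (\<lambda>y. \<bar>g y\<bar>) B) summable_on A"
      by (rule summable_on_cmult_left[OF f'])
  qed auto
  then have "(\<lambda>(x, y). \<bar>f x\<bar> * \<bar>g y\<bar>) summable_on S"
    using assms(3) by (rule summable_on_subset)
  then have "(\<lambda>z. norm (h z)) summable_on S"
  proof (rule Infinite_Sum.abs_summable_on_comparison_test')
    fix z assume z: "z \<in> S"
    obtain x y where xy: "z = (x, y)" by fastforce
    have "f x * g y \<le> \<bar>f x\<bar> * \<bar>g y\<bar>"
      using abs_ge_self[of "f x * g y"] by (simp add: abs_mult)
    then show "norm (h z) \<le> (case z of (x, y) \<Rightarrow> \<bar>f x\<bar> * \<bar>g y\<bar>)"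
      using le[of x y] z by (simp add: xy)
  qed
  then show ?thesis by (rule abs_summable_summable)
qed

text \<open>Fubini with one value \<open>S\<close> shared by both iterated sums: the total can be
  identified from the side known in closed form and then read off on the other.\<close>

lemma has_sum_exchange:
  fixes h :: "'a \<Rightarrow> 'b \<Rightarrow> complex"
  assumes "(\<lambda>(x, y). h x y) summable_on A \<times> B"
    and row: "\<And>x. x \<in> A \<Longrightarrow> (h x has_sum r x) B"
    and col: "\<And>y. y \<in> B \<Longrightarrow> ((\<lambda>x. h x y) has_sum c y) A"
  obtains S where "(r has_sum S) A" "(c has_sum S) B"
proof -
  obtain S where S: "((\<lambda>(x, y). h x y) has_sum S) (A \<times> B)"
    using assms(1) by (auto simp: summable_on_def)
  have "(r has_sum S) A"
    by (rule has_sum_SigmaD[OF S]) (use row in simp)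
  moreover have "((\<lambda>(y, x). h x y) has_sum S) (B \<times> A)"
    using S by (subst (asm) has_sum_swap) simp
  then have "(c has_sum S) B"
    by (rule has_sum_SigmaD) (use col in simp)
  ultimately show ?thesis by (rule that)
qed

lemma has_sum_antidiagonal:
  fixes h :: "nat \<Rightarrow> nat \<Rightarrow> complex"
  assumes "(\<lambda>(m, n). h m n) summable_on UNIV"
    and row: "\<And>m. (h m has_sum r m) UNIV"
    and diag: "\<And>N. (\<Sum>m\<le>N. h m (N - m)) = d N"
  obtains S where "(r has_sum S) UNIV" "(d has_sum S) UNIV"
proof -
  obtain S where S: "((\<lambda>(m, n). h m n) has_sum S) (UNIV \<times> UNIV)"
    using assms(1) by (auto simp: summable_on_def)
  have "(r has_sum S) UNIV"
    by (rule has_sum_SigmaD[OF S]) (use row in simp)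
  moreover have "((\<lambda>(m, n). h m n) has_sum S) (UNIV \<times> UNIV) \<longleftrightarrow>
      ((\<lambda>(N, m). h m (N - m)) has_sum S) (Sigma UNIV (\<lambda>N. {..N}))"
    by (rule has_sum_reindex_bij_witness[of _ "\<lambda>(N, m). (m, N - m)" "\<lambda>(m, n). (m + n, m)"]) auto
  with S have "((\<lambda>(N, m). h m (N - m)) has_sum S) (Sigma UNIV (\<lambda>N. {..N}))"
    by blast
  then have "(d has_sum S) UNIV"
    by (rule has_sum_SigmaD) (simp add: diag[symmetric] has_sum_finite_iff)
  ultimately show ?thesis by (rule that)
qed

text \<open>A pair (i, j) is determined by its difference d and its minimum, and at most one of
  \<open>nat d\<close> and \<open>nat (- d)\<close> is nonzero. For a power series in a times one in
  1/a this collects the coefficient of a^d.\<close>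

lemma has_sum_difference_diagonal:
  fixes h :: "nat \<Rightarrow> nat \<Rightarrow> complex"
  assumes S: "((\<lambda>(i, j). h i j) has_sum S) UNIV"
    and diag: "\<And>d. ((\<lambda>j. h (j + nat d) (j + nat (- d))) has_sum c d) UNIV"
  shows "(c has_sum S) (UNIV :: int set)"
proof -
  have "((\<lambda>(i, j). h i j) has_sum S) UNIV \<longleftrightarrow>
      ((\<lambda>(d, j). h (j + nat d) (j + nat (- d))) has_sum S) (UNIV \<times> UNIV)"
    by (rule has_sum_reindex_bij_witness[of _ "\<lambda>(d, j). (j + nat d, j + nat (- d))"
          "\<lambda>(i, j). (int i - int j, min i j)"])
       (auto simp: min_def nat_diff_distrib' split: if_splits)
  with S have "((\<lambda>(d, j). h (j + nat d) (j + nat (- d))) has_sum S) (UNIV \<times> UNIV)"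
    by blast
  then show ?thesis
    by (rule has_sum_SigmaD) (use diag in simp)
qed

lemma summable_on_int_split:
  fixes f :: "int \<Rightarrow> real"
  assumes "(\<lambda>n. f (int n)) summable_on UNIV" "(\<lambda>n. f (- int n)) summable_on UNIV"
  shows "f summable_on UNIV"
proof -
  have 1: "f summable_on (int ` UNIV)"
    by (subst summable_on_reindex) (use assms(1) in \<open>auto simp: o_def\<close>)
  have 2: "f summable_on ((\<lambda>n. - int n) ` UNIV)"
    by (subst summable_on_reindex) (use assms(2) in \<open>auto simp: o_def inj_def\<close>)
  have "(UNIV :: int set) = int ` UNIV \<union> (\<lambda>n. - int n) ` UNIV"
  proof -
    have "z \<in> int ` UNIV \<union> (\<lambda>n. - int n) ` UNIV" for z :: int
      by (cases z rule: int_cases2) auto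
    then show ?thesis by blast
  qed
  with summable_on_union[OF 1 2] show ?thesis by simp
qed

lemma choose_two_add: "(m + n) choose 2 = (m choose 2) + (n choose 2) + m * n"
  by (induction n) (auto simp: numeral_2_eq_2)

lemma choose_two_Suc: "Suc n choose 2 = n + (n choose 2)"
  by (simp add: numeral_2_eq_2)

lemma square_eq_choose_two: "n * n = 2 * (n choose 2) + n"
  by (induction n) (auto simp: choose_two_Suc)

text \<open>The ratio of consecutive terms is r^n y, which tends to 0 for every y. This quadratic
  decay is the standard majorant below.\<close>

lemma summable_power_choose_two:
  fixes r y :: real
  assumes "0 \<le> r" "r < 1" "0 \<le> y"
  shows "summable (\<lambda>n. r ^ (n choose 2) * y ^ n)"
proof -
  have "(\<lambda>n. r ^ n * y) \<longlonglongrightarrow> 0"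
    by (rule tendsto_mult_left_zero) (use assms in \<open>auto intro!: LIMSEQ_power_zero\<close>)
  then have "eventually (\<lambda>n. r ^ n * y < 1 / 2) sequentially"
    by (rule order_tendstoD) auto
  then obtain N where N: "\<And>n. n \<ge> N \<Longrightarrow> r ^ n * y < 1 / 2"
    by (auto simp: eventually_at_top_linorder)
  show ?thesis
  proof (rule summable_ratio_test[of "1/2" N])
    fix n assume "n \<ge> N"
    then have "(r ^ n * y) * (r ^ (n choose 2) * y ^ n) \<le> 1 / 2 * (r ^ (n choose 2) * y ^ n)"
      using N assms by (intro mult_right_mono) (auto simp: less_imp_le)
    then show "norm (r ^ (Suc n choose 2) * y ^ Suc n) \<le> 1 / 2 * norm (r ^ (n choose 2) * y ^ n)"
      using assms by (simp add: choose_two_Suc power_add mult_ac)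
  qed auto
qed

lemma tail_sum_upd: "j < i \<Longrightarrow> tail_sum k (\<nu>(j := x)) i = tail_sum k \<nu> i"
  by (auto simp: tail_sum_def intro!: sum.cong)

lemma tail_sum_head: "j < k \<Longrightarrow> tail_sum k \<nu> j = \<nu> j + tail_sum k \<nu> (Suc j)"
  by (simp add: tail_sum_def sum.atLeast_Suc_lessThan)

subsection \<open>Finite and infinite shifted factorials\<close>

text \<open>A finite product, so that algebra with it needs no nonvanishing of infinite products;
  \<open>qpoch_q_nat\<close> links it to \<open>qpoch\<close>.\<close>

definition qfac :: "complex \<Rightarrow> complex \<Rightarrow> nat \<Rightarrow> complex" where
  "qfac q x n = (\<Prod>j<n. 1 - x * q ^ j)"

lemma qfac_0 [simp]: "qfac q x 0 = 1"
  by (simp add: qfac_def)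

lemma qfac_Suc: "qfac q x (Suc n) = qfac q x n * (1 - x * q ^ n)"
  by (simp add: qfac_def)

lemma qfac_add: "qfac q x (m + n) = qfac q x m * qfac q (x * q ^ m) n"
  by (induction n) (auto simp: qfac_Suc power_add mult_ac)

lemma qfac_Suc': "qfac q x (Suc n) = (1 - x) * qfac q (x * q) n"
  using qfac_add[of q x 1 n] by (simp add: qfac_Suc)

text \<open>A locale, because the triple product is used for two bases: q and its power with
  exponent \<kappa>.\<close>

locale nome =
  fixes q :: complex
  assumes q_nz: "q \<noteq> 0" and norm_q: "norm q < 1"
begin

abbreviation P :: "nat \<Rightarrow> complex" where
  "P \<equiv> qfac q q"

lemma norm_q_power_le: "norm (q ^ n) \<le> 1"
  using norm_q by (simp add: norm_power power_le_one)

lemma q_power_neq_1: "n > 0 \<Longrightarrow> q ^ n \<noteq> 1"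
  using norm_q power_less_one_iff[of "norm q" n] by (auto simp flip: norm_power)

lemma P_Suc: "P (Suc n) = P n * (1 - q ^ Suc n)"
  by (simp add: qfac_Suc)

lemma P_nz [simp]: "P n \<noteq> 0"
  using q_power_neq_1 by (induction n) (auto simp: P_Suc simp del: power_Suc)

lemma P_add: "P (m + n) = P m * qfac q (q ^ Suc m) n"
  using qfac_add[of q q m n] by simp

text \<open>The inequality 1 + t <= exp t in each factor leaves a geometric series in the exponent,
  which bounds all n at once.\<close>

lemma norm_qfac_le: "norm (qfac q x n) \<le> exp (norm x / (1 - norm q))"
proof -
  have "norm (qfac q x n) = (\<Prod>j<n. norm (1 - x * q ^ j))"
    by (simp add: qfac_def prod_norm)
  also have "\<dots> \<le> (\<Prod>j<n. exp (norm x * norm q ^ j))"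
  proof (rule prod_mono, safe)
    fix j
    have "norm (1 - x * q ^ j) \<le> 1 + norm x * norm q ^ j"
      using norm_triangle_ineq4[of 1 "x * q ^ j"] by (simp add: norm_mult norm_power)
    also have "\<dots> \<le> exp (norm x * norm q ^ j)"
      by (rule exp_ge_add_one_self)
    finally show "norm (1 - x * q ^ j) \<le> exp (norm x * norm q ^ j)" .
  qed auto
  also have "\<dots> = exp (norm x * (\<Sum>j<n. norm q ^ j))"
    by (simp add: exp_sum sum_distrib_left)
  also have "\<dots> \<le> exp (norm x * (1 / (1 - norm q)))"
  proof -
    have "(\<Sum>j<n. norm q ^ j) \<le> (\<Sum>j. norm q ^ j)"
      by (rule sum_le_suminf) (use norm_q in auto)
    also have "\<dots> = 1 / (1 - norm q)"
      using norm_q by (simp add: suminf_geometric)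
    finally show ?thesis by (subst exp_le_cancel_iff) (rule mult_left_mono, auto)
  qed
  finally show ?thesis by simp
qed

lemma convergent_qpoch_inf: "convergent_prod (\<lambda>j. 1 - x * q ^ j)"
proof (rule abs_convergent_prod_imp_convergent_prod, rule summable_imp_abs_convergent_prod)
  show "summable (\<lambda>j. norm (1 - x * q ^ j - 1))"
    using norm_q by (simp add: norm_mult norm_power summable_geometric summable_mult)
qed

lemma qfac_tendsto: "qfac q x \<longlonglongrightarrow> qpoch_inf x q"
proof -
  have "(\<lambda>n. qfac q x (Suc n)) \<longlonglongrightarrow> qpoch_inf x q"
    using convergent_prod_LIMSEQ[OF convergent_qpoch_inf, of x]
    by (simp add: qfac_def qpoch_inf_def lessThan_Suc_atMost)
  then show ?thesis by (rule LIMSEQ_imp_Suc)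
qed

lemma norm_qpoch_inf_le: "norm (qpoch_inf x q) \<le> exp (norm x / (1 - norm q))"
  by (rule LIMSEQ_le_const2[OF tendsto_norm[OF qfac_tendsto]]) (auto intro: norm_qfac_le)

lemma qpoch_inf_split: "qpoch_inf x q = qfac q x n * qpoch_inf (x * q ^ n) q"
proof (rule LIMSEQ_unique)
  show "(\<lambda>m. qfac q x (m + n)) \<longlonglongrightarrow> qpoch_inf x q"
    by (rule LIMSEQ_ignore_initial_segment[OF qfac_tendsto])
  have "(\<lambda>m. qfac q x n * qfac q (x * q ^ n) m) \<longlonglongrightarrow> qfac q x n * qpoch_inf (x * q ^ n) q"
    by (intro tendsto_intros qfac_tendsto)
  then show "(\<lambda>m. qfac q x (m + n)) \<longlonglongrightarrow> qfac q x n * qpoch_inf (x * q ^ n) q"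
    by (simp add: qfac_add add.commute[of _ n])
qed

lemma qpoch_inf_nz: "(\<And>j. x * q ^ j \<noteq> 1) \<Longrightarrow> qpoch_inf x q \<noteq> 0"
  unfolding qpoch_inf_def by (rule prodinf_nonzero[OF convergent_qpoch_inf]) (metis right_minus_eq)

lemma qpoch_inf_q_nz: "qpoch_inf q q \<noteq> 0"
  by (rule qpoch_inf_nz) (metis power_Suc q_power_neq_1 zero_less_Suc)

lemma qpoch_inf_1 [simp]: "qpoch_inf 1 q = 0"
  using qpoch_inf_split[of 1 1] by (simp add: qfac_Suc)

lemma qpoch_inf_q_eq: "qpoch_inf q q = P n * qpoch_inf (q ^ Suc n) q"
  using qpoch_inf_split[of q n] by simp

text \<open>The sequence converges because (q;q)_inf is nonzero, and a convergent sequence is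
  bounded.\<close>

lemma inverse_P_bounded: "\<exists>K\<ge>1. \<forall>n. norm (1 / P n) \<le> K"
proof -
  have "(\<lambda>n. 1 / P n) \<longlonglongrightarrow> 1 / qpoch_inf q q"
    by (intro tendsto_intros qfac_tendsto qpoch_inf_q_nz)
  then have "Bseq (\<lambda>n. 1 / P n)"
    using convergentI convergent_imp_Bseq by blast
  then obtain K where "\<forall>n. norm (1 / P n) \<le> K"
    by (auto simp: Bseq_def)
  then show ?thesis
    by (intro exI[of _ "max 1 K"]) (auto simp: le_max_iff_disj)
qed

text \<open>One constant bounding all |1/(q;q)_n|, so that majorants with different denominators can
  share it.\<close>

definition K :: real where
  "K = (SOME K. K \<ge> 1 \<and> (\<forall>n. norm (1 / P n) \<le> K))"

lemma K_ge_1: "K \<ge> 1" and norm_inverse_P: "norm (1 / P n) \<le> K"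
  using someI_ex[OF inverse_P_bounded] unfolding K_def by auto

lemma K_nonneg: "K \<ge> 0"
  using K_ge_1 by simp

lemma norm_divide_P_le: "norm (z / P n) \<le> K * norm z"
  using mult_right_mono[OF norm_inverse_P, of "norm z" n] by (simp add: norm_divide)

lemma summable_norm_q_choose_two:
  "y \<ge> 0 \<Longrightarrow> summable (\<lambda>n. norm q ^ (n choose 2) * y ^ n)"
  using summable_power_choose_two norm_q by simp

lemma summable_on_norm_q_choose_two:
  "y \<ge> 0 \<Longrightarrow> (\<lambda>n. norm q ^ (n choose 2) * y ^ n) summable_on UNIV"
  by (intro summable_nonneg_imp_summable_on summable_norm_q_choose_two) auto

section \<open>Euler's expansion of (x;q)_inf and the finite q-binomial theorem\<close>

definition euler :: "complex \<Rightarrow> nat \<Rightarrow> complex" where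
  "euler x s = (- 1) ^ s * q ^ (s choose 2) * x ^ s / P s"

lemma norm_euler_le: "norm (euler x s) \<le> K * (norm q ^ (s choose 2) * norm x ^ s)"
  unfolding euler_def by (rule order.trans[OF norm_divide_P_le]) (simp add: norm_mult norm_power)

lemma summable_norm_euler: "summable (\<lambda>s. norm (euler x s))"
  by (rule summable_comparison_test'[OF summable_mult[OF summable_norm_q_choose_two[of "norm x"], of K]])
     (use norm_euler_le in auto)

text \<open>Subtracting the terms of index s+1 at x and at xq cancels the last factor of
  \<open>P (Suc s)\<close> and leaves -x times the term of index s at xq. The resulting functional
  equation is also that of (x;q)_inf.\<close>

lemma suminf_euler_step: "suminf (euler x) = (1 - x) * suminf (euler (x * q))"
proof -
  have sm: "summable (euler y)" for y
    using summable_norm_euler by (rule summable_norm_cancel)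
  have eq: "euler x (Suc s) - euler (x * q) (Suc s) = - x * euler (x * q) s" for s
  proof -
    have nz: "1 - q * q ^ s \<noteq> 0"
      using q_power_neq_1[of "Suc s"] by auto
    define c where "c = (- 1) ^ Suc s * q ^ (Suc s choose 2) * x ^ Suc s / P s"
    have "euler x (Suc s) = c / (1 - q * q ^ s)" "euler (x * q) (Suc s) = c * (q * q ^ s) / (1 - q * q ^ s)"
      by (simp_all add: euler_def P_Suc power_mult_distrib c_def mult_ac)
    then have "euler x (Suc s) - euler (x * q) (Suc s) = c * (1 - q * q ^ s) / (1 - q * q ^ s)"
      by (simp add: right_diff_distrib diff_divide_distrib)
    also have "\<dots> = c"
      using nz by simp
    also have "c = - x * euler (x * q) s"
      by (simp add: c_def euler_def choose_two_Suc power_add power_mult_distrib)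
    finally show ?thesis .
  qed
  have "suminf (euler x) - suminf (euler (x * q)) = (\<Sum>s. euler x s - euler (x * q) s)"
    by (rule suminf_diff[OF sm sm])
  also have "\<dots> = (\<Sum>s. euler x (Suc s) - euler (x * q) (Suc s))"
    using suminf_split_head[OF summable_diff[OF sm sm], of x "x * q"] by (simp add: euler_def)
  also have "\<dots> = - x * suminf (euler (x * q))"
    unfolding eq by (rule suminf_mult[OF sm])
  finally show ?thesis by (simp add: algebra_simps)
qed

text \<open>Iterating the functional equation gives f(x) = (x;q)_n f(x q^n). As n grows, continuity
  of the power series at 0 and f(0) = 1 give the product.\<close>

lemma euler_has_sum: "(euler x has_sum qpoch_inf x q) UNIV"
proof -
  define f where "f y = suminf (euler y)" for y
  have f: "f y = (\<Sum>n. ((- 1) ^ n * q ^ (n choose 2) / P n) * y ^ n)" for y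
    by (simp add: f_def euler_def[abs_def])
  have "summable (\<lambda>n. ((- 1) ^ n * q ^ (n choose 2) / P n) * y ^ n)" for y
    using summable_norm_cancel[OF summable_norm_euler[of y]] by (simp add: euler_def[abs_def])
  then have "isCont f 0"
    unfolding f[abs_def] by (rule isCont_powser_converges_everywhere)
  moreover have "(\<lambda>n. x * q ^ n) \<longlonglongrightarrow> 0"
    using norm_q by (intro tendsto_mult_right_zero LIMSEQ_power_zero)
  ultimately have "(\<lambda>n. f (x * q ^ n)) \<longlonglongrightarrow> f 0"
    by (rule isCont_tendsto_compose)
  then have "(\<lambda>n. qfac q x n * f (x * q ^ n)) \<longlonglongrightarrow> qpoch_inf x q * f 0"
    by (intro tendsto_mult qfac_tendsto)
  moreover have "qfac q x n * f (x * q ^ n) = f x" for n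
  proof (induction n)
    case (Suc n)
    then show ?case
      using suminf_euler_step[of "x * q ^ n"] by (simp add: qfac_Suc f_def mult_ac)
  qed simp
  ultimately have "f x = qpoch_inf x q * f 0"
    by (simp add: LIMSEQ_const_iff)
  moreover have "f 0 = 1"
    unfolding f by (subst powser_zero) (simp add: numeral_2_eq_2)
  ultimately have "suminf (euler x) = qpoch_inf x q"
    by (simp add: f_def)
  then have "euler x sums qpoch_inf x q"
    using summable_sums[OF summable_norm_cancel[OF summable_norm_euler[of x]]] by simp
  then show ?thesis
    by (rule norm_summable_imp_has_sum[OF summable_norm_euler])
qed

text \<open>The split 1 - q^(N+1) = (1 - q^j) + q^j (1 - q^(N+1-j)) cancels a factor of
  \<open>P j\<close> in one part and of \<open>P (Suc N - j)\<close> in the other. Both parts become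
  the sum for N at zq, with weights -z and 1.\<close>

lemma q_binomial:
  "(\<Sum>j\<le>N. (- 1) ^ j * q ^ (j choose 2) * z ^ j / (P j * P (N - j))) = qfac q z N / P N"
proof (induction N arbitrary: z)
  case (Suc N)
  define t where "t z j = (- 1) ^ j * q ^ (j choose 2) * z ^ j / (P j * P (N - j))" for z j
  define u where "u j = (- 1) ^ j * q ^ (j choose 2) * z ^ j / (P j * P (Suc N - j))" for j
  have nz: "1 - q ^ Suc n \<noteq> 0" for n
    using q_power_neq_1[of "Suc n"] by (simp del: power_Suc)
  have split: "(1 - q ^ Suc N) * u j = (1 - q ^ j) * u j + q ^ j * (1 - q ^ (Suc N - j)) * u j"
    if "j \<le> Suc N" for j
  proof -
    have "q ^ Suc N = q ^ j * q ^ (Suc N - j)"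
      using that by (metis le_add_diff_inverse power_add)
    then show ?thesis by (simp add: algebra_simps)
  qed
  have A: "(1 - q ^ Suc j) * u (Suc j) = - z * t (z * q) j" for j
    using nz[of j] unfolding u_def t_def
    by (simp add: P_Suc choose_two_Suc power_add power_mult_distrib field_simps)
  have B: "q ^ j * (1 - q ^ (Suc N - j)) * u j = t (z * q) j" if "j \<le> N" for j
    using nz[of "N - j"] that unfolding u_def t_def
    by (simp add: Suc_diff_le P_Suc power_mult_distrib field_simps)
  have "(1 - q ^ Suc N) * (\<Sum>j\<le>Suc N. u j) =
      (\<Sum>j\<le>Suc N. (1 - q ^ j) * u j) + (\<Sum>j\<le>Suc N. q ^ j * (1 - q ^ (Suc N - j)) * u j)"
    using split by (simp add: sum_distrib_left flip: sum.distrib del: sum.atMost_Suc power_Suc)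
  also have "(\<Sum>j\<le>Suc N. (1 - q ^ j) * u j) = (\<Sum>j\<le>N. - z * t (z * q) j)"
    by (subst sum.atMost_Suc_shift) (simp add: A del: power_Suc)
  also have "(\<Sum>j\<le>Suc N. q ^ j * (1 - q ^ (Suc N - j)) * u j) = (\<Sum>j\<le>N. t (z * q) j)"
    by (simp add: B)
  also have "(\<Sum>j\<le>N. - z * t (z * q) j) + (\<Sum>j\<le>N. t (z * q) j) = (1 - z) * (\<Sum>j\<le>N. t (z * q) j)"
    by (simp add: sum_distrib_left[symmetric] algebra_simps sum_negf)
  also have "(\<Sum>j\<le>N. t (z * q) j) = qfac q (z * q) N / P N"
    unfolding t_def by (rule Suc.IH)
  finally have "(1 - q ^ Suc N) * (\<Sum>j\<le>Suc N. u j) = qfac q z (Suc N) / P N"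
    by (simp add: qfac_Suc')
  then show ?case
    using nz[of N] unfolding u_def by (simp add: P_Suc field_simps del: power_Suc sum.atMost_Suc)
qed (simp add: numeral_2_eq_2)

subsection \<open>Products of two infinite factorials\<close>

lemma minus_one_power_cancel: "(- 1 :: complex) ^ (j + m) * (- 1) ^ j = (- 1) ^ m"
  by (induction j) simp_all

definition phi_term :: "nat \<Rightarrow> complex \<Rightarrow> nat \<Rightarrow> complex" where
  "phi_term r z N = (- 1) ^ N * q ^ ((N choose 2) + N * (r + 1)) * qfac q z N / P N"

text \<open>The coefficient function in the expansion of (q,u,v;q)_inf with uv = zq, where r is the
  absolute value of the index. In this form it collapses to 1 at z = 1, and for z a power of q the
  factor \<open>qfac q z N\<close> merges with a preceding \<open>P\<close>.\<close>

definition phi :: "nat \<Rightarrow> complex \<Rightarrow> complex" where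
  "phi r z = (\<Sum>\<^sub>\<infinity>N. phi_term r z N)"

lemma norm_phi_term_le:
  "norm (phi_term r z N) \<le> K * (exp (norm z / (1 - norm q)) * norm q ^ N)"
proof -
  have "norm (phi_term r z N) \<le> K * norm ((- 1) ^ N * q ^ ((N choose 2) + N * (r + 1)) * qfac q z N)"
    unfolding phi_term_def by (rule norm_divide_P_le)
  also have "\<dots> = K * (norm (qfac q z N) * norm q ^ ((N choose 2) + N * (r + 1)))"
    by (simp add: norm_mult norm_power mult_ac)
  also have "\<dots> \<le> K * (exp (norm z / (1 - norm q)) * norm q ^ N)"
    using norm_q K_nonneg
    by (intro mult_left_mono mult_mono norm_qfac_le power_decreasing) (auto simp: less_imp_le)
  finally show ?thesis .
qed

lemma summable_on_norm_q_power: "(\<lambda>N. norm q ^ N) summable_on (UNIV :: nat set)"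
  by (rule summable_nonneg_imp_summable_on) (use norm_q in auto)

lemma phi_has_sum: "(phi_term r z has_sum phi r z) UNIV"
proof -
  have "(\<lambda>N. K * (exp (norm z / (1 - norm q)) * norm q ^ N)) summable_on UNIV"
    by (intro summable_on_cmult_right summable_on_norm_q_power)
  then have "(\<lambda>N. norm (phi_term r z N)) summable_on UNIV"
    by (rule Infinite_Sum.abs_summable_on_comparison_test') (rule norm_phi_term_le)
  then show ?thesis
    unfolding phi_def by (rule has_sum_infsum[OF abs_summable_summable])
qed

lemma phi_1 [simp]: "phi r 1 = 1"
proof -
  have "(phi_term r 1 has_sum 1) UNIV"
  proof (rule has_sum_finite_neutralI[of "{0}"])
    fix N :: nat assume "N \<in> UNIV - {0}"
    then obtain n where "N = Suc n" by (cases N) auto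
    then show "phi_term r 1 N = 0"
      by (simp add: phi_term_def qfac_Suc')
  qed (auto simp: phi_term_def numeral_2_eq_2)
  then show ?thesis
    using phi_has_sum has_sum_unique by blast
qed

text \<open>The bound is uniform in r and z, so it can be multiplied with any summable bilateral
  series.\<close>

lemma norm_phi_le:
  assumes "norm z \<le> 1"
  shows "norm (phi r z) \<le> (\<Sum>\<^sub>\<infinity>N. K * (exp (1 / (1 - norm q)) * norm q ^ N))"
proof (rule norm_infsum_le[OF _ has_sum_infsum])
  show "(phi_term r z has_sum phi r z) UNIV" by (rule phi_has_sum)
  show "(\<lambda>N. K * (exp (1 / (1 - norm q)) * norm q ^ N)) summable_on UNIV"
    by (intro summable_on_cmult_right summable_on_norm_q_power)
  fix N
  have "norm z / (1 - norm q) \<le> 1 / (1 - norm q)"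
    using assms norm_q by (intro divide_right_mono) auto
  then have "K * (exp (norm z / (1 - norm q)) * norm q ^ N) \<le> K * (exp (1 / (1 - norm q)) * norm q ^ N)"
    using K_nonneg by (intro mult_left_mono mult_right_mono) auto
  then show "norm (phi_term r z N) \<le> K * (exp (1 / (1 - norm q)) * norm q ^ N)"
    using norm_phi_term_le order.trans by blast
qed

text \<open>Replace 1/(q;q)_(j+r) by (q^(j+r+1);q)_inf / (q;q)_inf, expand by Euler, and collect j +
  s = N; the q-binomial theorem sums each group. At z = 1 this is the Durfee rectangle
  identity.\<close>

lemma durfee_has_sum:
  "((\<lambda>j. q ^ (j * j + j * r) * z ^ j / (P j * P (j + r))) has_sum phi r z / qpoch_inf q q) UNIV"
proof -
  define h where "h j s = q ^ (j * j + j * r) * z ^ j / P j * euler (q ^ Suc (j + r)) s" for j s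
  define t where "t j = q ^ (j * j + j * r) * z ^ j / (P j * P (j + r)) * qpoch_inf q q" for j
  obtain S where S: "(t has_sum S) UNIV" "(phi_term r z has_sum S) UNIV"
  proof (rule has_sum_antidiagonal)
    show "(\<lambda>(m, n). h m n) summable_on UNIV"
    proof (rule summable_on_dominated_product)
      show "(\<lambda>j. K * (norm q ^ (j choose 2) * norm z ^ j)) summable_on UNIV"
        by (intro summable_on_cmult_right summable_on_norm_q_choose_two) auto
      show "(\<lambda>s. K * (norm q ^ (s choose 2) * 1 ^ s)) summable_on UNIV"
        by (intro summable_on_cmult_right summable_on_norm_q_choose_two) auto
      fix j s
      have "norm (q ^ (j * j + j * r) * z ^ j / P j) \<le> K * (norm q ^ (j * j + j * r) * norm z ^ j)"
        by (rule order.trans[OF norm_divide_P_le]) (simp add: norm_mult norm_power)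
      also have "\<dots> \<le> K * (norm q ^ (j choose 2) * norm z ^ j)"
        using norm_q K_nonneg
        by (intro mult_left_mono mult_right_mono power_decreasing) (auto simp: square_eq_choose_two)
      finally have 1: "norm (q ^ (j * j + j * r) * z ^ j / P j) \<le> K * (norm q ^ (j choose 2) * norm z ^ j)" .
      have "norm (euler (q ^ Suc (j + r)) s) \<le> K * (norm q ^ (s choose 2) * norm (q ^ Suc (j + r)) ^ s)"
        by (rule norm_euler_le)
      also have "\<dots> \<le> K * (norm q ^ (s choose 2) * 1 ^ s)"
        using K_nonneg by (intro mult_left_mono power_mono norm_q_power_le) auto
      finally have 2: "norm (euler (q ^ Suc (j + r)) s) \<le> K * (norm q ^ (s choose 2) * 1 ^ s)" .
      show "norm (case (j, s) of (m, n) \<Rightarrow> h m n) \<le>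
          K * (norm q ^ (j choose 2) * norm z ^ j) * (K * (norm q ^ (s choose 2) * 1 ^ s))"
        using mult_mono[OF 1 2] K_nonneg by (simp only: h_def norm_mult prod.case) auto
    qed auto
    show "(h j has_sum t j) UNIV" for j
    proof -
      have "t j = q ^ (j * j + j * r) * z ^ j / P j * qpoch_inf (q ^ Suc (j + r)) q"
        unfolding t_def qpoch_inf_q_eq[of "j + r"] by simp
      then show ?thesis
        unfolding h_def by (simp only: has_sum_cmult_right euler_has_sum)
    qed
    show "(\<Sum>j\<le>N. h j (N - j)) = phi_term r z N" for N
    proof -
      have "h j (N - j) = (- 1) ^ N * q ^ ((N choose 2) + N * (r + 1)) *
          ((- 1) ^ j * q ^ (j choose 2) * z ^ j / (P j * P (N - j)))" if jN: "j \<le> N" for j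
      proof -
        obtain m where m: "N = j + m"
          using le_Suc_ex[OF jN] by blast
        have *: "j * j + j * r + (m choose 2) + Suc (j + r) * m =
            ((j + m) choose 2) + (j + m) * (r + 1) + (j choose 2)"
          by (simp add: choose_two_add square_eq_choose_two algebra_simps)
        have "h j (N - j) = (- 1) ^ m * z ^ j *
            q ^ (j * j + j * r + (m choose 2) + Suc (j + r) * m) / (P j * P m)"
          unfolding h_def euler_def m power_add[of q _ "Suc (j + r) * m"] power_add[of q _ "m choose 2"]
            power_mult[of q "Suc (j + r)" m]
          by (simp add: mult_ac del: power_Suc mult_Suc)
        then show ?thesis
          unfolding * minus_one_power_cancel[of j m, symmetric] m
          by (simp add: power_add[of _ _ "j choose 2"] mult_ac del: power_Suc)
      qed
      then have "(\<Sum>j\<le>N. h j (N - j)) = (- 1) ^ N * q ^ ((N choose 2) + N * (r + 1)) *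
          (\<Sum>j\<le>N. (- 1) ^ j * q ^ (j choose 2) * z ^ j / (P j * P (N - j)))"
        by (simp add: sum_distrib_left)
      then show ?thesis
        by (simp add: q_binomial phi_term_def)
    qed
  qed
  have "S = phi r z"
    using S(2) phi_has_sum has_sum_unique by blast
  with S(1) show ?thesis
    unfolding t_def using qpoch_inf_q_nz by (subst (asm) has_sum_cmult_left_iff) auto
qed

text \<open>For uv = q this is the general term of Jacobi's theta series in u. Keeping v separate
  allows other values of uv and avoids negative exponents.\<close>

definition wing :: "complex \<Rightarrow> complex \<Rightarrow> int \<Rightarrow> complex" where
  "wing u v d = (- 1) ^ nat \<bar>d\<bar> * q ^ (nat \<bar>d\<bar> choose 2) * (if d \<ge> 0 then u ^ nat d else v ^ nat (- d))"

text \<open>Multiply the Euler expansions of both factors and fix the difference d of the indices.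
  The remaining sum contains only (uv)^j = (zq)^j and is the Durfee series.\<close>

lemma qpoch_inf_product_has_sum:
  assumes uv: "u * v = z * q"
  shows "((\<lambda>d. wing u v d * phi (nat \<bar>d\<bar>) z) has_sum
      qpoch_inf q q * qpoch_inf u q * qpoch_inf v q) (UNIV :: int set)"
proof -
  define D where "D r j = q ^ (j * j + j * r) * z ^ j / (P j * P (j + r))" for r j
  have "((\<lambda>(i, j). euler u i * euler v j) has_sum qpoch_inf u q * qpoch_inf v q) (UNIV \<times> UNIV)"
  proof (rule has_sum_SigmaI)
    show "((\<lambda>y. case (x, y) of (i, j) \<Rightarrow> euler u i * euler v j) has_sum euler u x * qpoch_inf v q) UNIV" for x
      using has_sum_cmult_right[OF euler_has_sum] by simp
    show "((\<lambda>x. euler u x * qpoch_inf v q) has_sum qpoch_inf u q * qpoch_inf v q) UNIV"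
      by (rule has_sum_cmult_left[OF euler_has_sum])
    have *: "(\<lambda>s. norm (euler x s)) summable_on UNIV" for x
      using summable_norm_euler by (intro summable_nonneg_imp_summable_on) auto
    show "(\<lambda>(i, j). euler u i * euler v j) summable_on UNIV \<times> UNIV"
      by (rule summable_on_dominated_product[OF * *]) (auto simp: norm_mult)
  qed
  then have "((\<lambda>(i, j). euler u i * euler v j) has_sum qpoch_inf u q * qpoch_inf v q) UNIV"
    by simp
  then have "((\<lambda>d. wing u v d * (phi (nat \<bar>d\<bar>) z / qpoch_inf q q)) has_sum
      qpoch_inf u q * qpoch_inf v q) UNIV"
  proof (rule has_sum_difference_diagonal)
    fix d :: int
    have aux: "euler x (j + r) * euler y j = (- 1) ^ r * q ^ (r choose 2) * x ^ r * D r j"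
      if xy: "x * y = z * q" for x y r j
    proof -
      have *: "((j + r) choose 2) + (j choose 2) + j = (r choose 2) + (j * j + j * r)"
        by (simp add: choose_two_add square_eq_choose_two)
      have "euler x (j + r) * euler y j =
          (- 1) ^ r * q ^ (((j + r) choose 2) + (j choose 2)) * x ^ r * (x * y) ^ j / (P j * P (j + r))"
        unfolding minus_one_power_cancel[of j r, symmetric] euler_def
        by (simp add: power_add power_mult_distrib mult_ac)
      also have "\<dots> = (- 1) ^ r * q ^ (((j + r) choose 2) + (j choose 2) + j) * x ^ r * z ^ j / (P j * P (j + r))"
        by (simp add: xy power_mult_distrib power_add mult_ac)
      finally show ?thesis
        unfolding * by (simp add: D_def power_add mult_ac)
    qed
    have "euler u (j + nat d) * euler v (j + nat (- d)) = wing u v d * D (nat \<bar>d\<bar>) j" for j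
    proof (cases "d \<ge> 0")
      case True
      then show ?thesis using aux[OF uv, of j "nat d"] by (simp add: wing_def)
    next
      case False
      then show ?thesis
        using aux[of v u j "nat (- d)"] uv by (simp add: wing_def mult.commute)
    qed
    then show "((\<lambda>j. euler u (j + nat d) * euler v (j + nat (- d))) has_sum
        wing u v d * (phi (nat \<bar>d\<bar>) z / qpoch_inf q q)) UNIV"
      unfolding D_def using has_sum_cmult_right[OF durfee_has_sum] by simp
  qed
  from has_sum_cmult_right[OF this, of "qpoch_inf q q"] show ?thesis
    using qpoch_inf_q_nz by (simp add: mult_ac)
qed

section \<open>Vanishing alternating sums and the evaluation of the coefficient sums\<close>

lemma q_binomial_vanish:
  assumes "t < M"
  shows "(\<Sum>m\<le>M. (- 1) ^ (M - m) * q ^ ((M - m) choose 2) * q ^ (m * t) / (P m * P (M - m))) = 0"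
proof -
  have "(\<Sum>m\<le>M. (- 1) ^ (M - m) * q ^ ((M - m) choose 2) * q ^ (m * t) / (P m * P (M - m))) =
      (\<Sum>i\<le>M. (- 1) ^ i * q ^ (i choose 2) * q ^ ((M - i) * t) / (P i * P (M - i)))"
    by (rule sum.reindex_bij_witness[of _ "\<lambda>i. M - i" "\<lambda>i. M - i"]) (auto simp: mult_ac)
  also have "\<dots> = (\<Sum>i\<le>M. q ^ (M * t) * ((- 1) ^ i * q ^ (i choose 2) * (1 / q ^ t) ^ i / (P i * P (M - i))))"
  proof (rule sum.cong[OF refl])
    fix i assume "i \<in> {..M}"
    then obtain l where "M = i + l" using le_Suc_ex[of i M] by auto
    then have "q ^ (M * t) * (1 / q ^ t) ^ i = q ^ ((M - i) * t)"
      using q_nz by (simp add: add_mult_distrib power_add power_one_over power_mult[symmetric] mult.commute[of t])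
    then show "(- 1) ^ i * q ^ (i choose 2) * q ^ ((M - i) * t) / (P i * P (M - i)) =
        q ^ (M * t) * ((- 1) ^ i * q ^ (i choose 2) * (1 / q ^ t) ^ i / (P i * P (M - i)))"
      by (simp add: mult_ac)
  qed
  also have "\<dots> = q ^ (M * t) * (qfac q (1 / q ^ t) M / P M)"
    by (simp only: q_binomial flip: sum_distrib_left)
  \<comment> \<open>The factor of index t is 1 - q^(-t) q^t = 0, and it is present because t <
    M.\<close>
  also have "qfac q (1 / q ^ t) M = 0"
    unfolding qfac_def using assms q_nz by (auto intro!: prod_zero bexI[of _ t])
  finally show ?thesis by simp
qed

text \<open>The quotient of \<open>P (c + m + Suc T)\<close> by \<open>P (m + c + 1)\<close> has T
  factors, so it is a polynomial of degree T in q^m. The alternating sum with M = T + 1 annihilates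
  each of its monomials.\<close>

lemma q_vandermonde_vanish:
  "(\<Sum>m\<le>Suc T. (- 1) ^ (Suc T - m) * q ^ ((Suc T - m) choose 2) *
      P (c + m + Suc T) / (P m * P (m + c + 1) * P (Suc T - m))) = 0"
proof -
  define w where "w m = (- 1) ^ (Suc T - m) * q ^ ((Suc T - m) choose 2) / (P m * P (Suc T - m))" for m
  define b where "b t = P T * ((- 1) ^ t * q ^ (t choose 2) * (q ^ (c + 2)) ^ t / (P t * P (T - t)))" for t
  have "P (c + m + Suc T) / P (m + c + 1) = (\<Sum>t\<le>T. b t * q ^ (m * t))" for m
  proof -
    have "P (c + m + Suc T) = P (m + c + 1) * qfac q (q ^ (m + c + 2)) T"
      using P_add[of "m + c + 1" T] by (simp add: add_ac)
    then have "P (c + m + Suc T) / P (m + c + 1) = P T * (qfac q (q ^ (m + c + 2)) T / P T)"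
      by simp
    also have "\<dots> = (\<Sum>t\<le>T. P T * ((- 1) ^ t * q ^ (t choose 2) * (q ^ (m + c + 2)) ^ t / (P t * P (T - t))))"
      by (simp only: q_binomial[symmetric] sum_distrib_left)
    also have "\<dots> = (\<Sum>t\<le>T. b t * q ^ (m * t))"
      by (rule sum.cong) (simp_all add: b_def power_add power_mult_distrib power_mult[symmetric] mult_ac)
    finally show ?thesis .
  qed
  then have "w m * (P (c + m + Suc T) / P (m + c + 1)) = (\<Sum>t\<le>T. b t * (w m * q ^ (m * t)))" for m
    by (simp add: sum_distrib_left mult_ac)
  then have "(\<Sum>m\<le>Suc T. w m * (P (c + m + Suc T) / P (m + c + 1))) =
      (\<Sum>t\<le>T. b t * (\<Sum>m\<le>Suc T. w m * q ^ (m * t)))"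
    unfolding sum_distrib_left by (simp only:) (rule sum.swap)
  also have "\<dots> = 0"
  proof (rule sum.neutral, safe)
    fix t assume "t \<le> T"
    then show "b t * (\<Sum>m\<le>Suc T. w m * q ^ (m * t)) = 0"
      using q_binomial_vanish[of t "Suc T"] by (simp add: w_def del: sum.atMost_Suc)
  qed
  finally show ?thesis
    by (simp add: w_def mult_ac del: sum.atMost_Suc)
qed

text \<open>
  For fixed \<open>L\<close>, \<open>c = 2 * L\<close> and \<open>r = \<bar>d\<bar>\<close> this evaluates the coefficient of \<open>a^d\<close> in the sum over \<open>n = L + m\<close>.
\<close>
lemma phi_sum:
  "((\<lambda>m. P (c + 2 * m) / (P m * P (m + c + 1)) * q ^ (m * (r + 1)) * phi r (q ^ (c + 2 * m + 1)))
     has_sum 1 / (1 - q ^ (c + 1))) UNIV"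
proof -
  define h where "h m N = P (c + 2 * m) / (P m * P (m + c + 1)) * q ^ (m * (r + 1)) *
      phi_term r (q ^ (c + 2 * m + 1)) N" for m N
  define d where "d M = (if M = 0 then 1 / (1 - q ^ (c + 1)) else 0)" for M :: nat
  define B where "B = exp (norm q / (1 - norm q))"
  \<comment> \<open>The choice z = q^(c+2m+1) makes \<open>qfac q z N\<close> continue
    \<open>P (c + 2 * m)\<close> up to \<open>P (c + 2 * m + N)\<close>.\<close>
  have h: "h m N = P (c + 2 * m + N) / P m / P (m + c + 1) / P N *
      ((- 1) ^ N * q ^ (N choose 2) * q ^ ((m + N) * (r + 1)))" for m N
  proof -
    have "P (c + 2 * m + N) = P (c + 2 * m) * qfac q (q ^ (c + 2 * m + 1)) N"
      using P_add[of "c + 2 * m" N] by simp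
    moreover have "q ^ (m * (r + 1)) * q ^ ((N choose 2) + N * (r + 1)) = q ^ (N choose 2) * q ^ ((m + N) * (r + 1))"
      by (simp add: power_add[symmetric] algebra_simps)
    ultimately show ?thesis
      unfolding h_def phi_term_def by (simp add: mult_ac del: power_Suc)
  qed
  have B: "norm (P n) \<le> B" for n
    unfolding B_def by (rule norm_qfac_le)
  have "norm (P (c + 2 * m + N) / P m / P (m + c + 1) / P N) \<le> K * (K * (K * B))" for m N
    by (intro order.trans[OF norm_divide_P_le] mult_left_mono K_nonneg B)
  then have bd: "norm (h m N) \<le> (K * (K * (K * B))) * (1 * norm q ^ (m + N))" for m N
    unfolding h norm_mult[of "_ / _"]
  proof (rule mult_mono)
    have "norm ((- 1) ^ N * q ^ (N choose 2) * q ^ ((m + N) * (r + 1))) =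
        norm (q ^ (N choose 2)) * norm q ^ ((m + N) * (r + 1))"
      by (simp add: norm_mult norm_power)
    also have "\<dots> \<le> 1 * norm q ^ (m + N)"
      using norm_q by (intro mult_mono norm_q_power_le power_decreasing) auto
    finally show "norm ((- 1) ^ N * q ^ (N choose 2) * q ^ ((m + N) * (r + 1))) \<le> 1 * norm q ^ (m + N)" .
  qed (use K_nonneg in \<open>auto simp: B_def\<close>)
  define rr where "rr m = P (c + 2 * m) / (P m * P (m + c + 1)) * q ^ (m * (r + 1)) *
      phi r (q ^ (c + 2 * m + 1))" for m
  obtain S where S: "(rr has_sum S) UNIV" "(d has_sum S) UNIV"
  proof (rule has_sum_antidiagonal)
    show "(\<lambda>(m, n). h m n) summable_on UNIV"
    proof (rule summable_on_dominated_product)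
      show "(\<lambda>m. (K * (K * (K * B))) * norm q ^ m) summable_on (UNIV :: nat set)"
        by (intro summable_on_cmult_right summable_on_norm_q_power)
      show "norm (case (m, n) of (m, n) \<Rightarrow> h m n) \<le> (K * (K * (K * B))) * norm q ^ m * norm q ^ n" for m n
        using bd[of m n] by (simp add: power_add mult_ac)
    qed (auto intro: summable_on_norm_q_power)
    show "(h m has_sum rr m) UNIV" for m
      unfolding h_def rr_def by (rule has_sum_cmult_right[OF phi_has_sum])
    show "(\<Sum>m\<le>M. h m (M - m)) = d M" for M
    proof (cases M)
      case 0
      then show ?thesis
        by (simp add: h d_def P_Suc numeral_2_eq_2)
    next
      case (Suc T)
      \<comment> \<open>On an antidiagonal the power involving r depends on M alone and leaves the
        sum, so the vanishing, and with it the final value, is independent of r.\<close>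
      have "h m (M - m) = q ^ (M * (r + 1)) * ((- 1) ^ (Suc T - m) * q ^ ((Suc T - m) choose 2) *
          P (c + m + Suc T) / (P m * P (m + c + 1) * P (Suc T - m)))" if "m \<le> M" for m
      proof -
        have "c + 2 * m + (M - m) = c + m + Suc T" "m + (M - m) = M"
          using that Suc by auto
        then show ?thesis
          using Suc unfolding h by (simp add: mult_ac add_ac del: power_Suc)
      qed
      then have "(\<Sum>m\<le>M. h m (M - m)) = q ^ (M * (r + 1)) * (\<Sum>m\<le>M. (- 1) ^ (Suc T - m) * q ^ ((Suc T - m) choose 2) *
          P (c + m + Suc T) / (P m * P (m + c + 1) * P (Suc T - m)))"
        by (simp add: sum_distrib_left)
      then show ?thesis
        using q_vandermonde_vanish[of T c] Suc by (simp add: d_def del: sum.atMost_Suc)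
    qed
  qed
  have "(d has_sum 1 / (1 - q ^ (c + 1))) UNIV"
    by (rule has_sum_finite_neutralI[of "{0}"]) (auto simp: d_def)
  then have "S = 1 / (1 - q ^ (c + 1))"
    using S(2) has_sum_unique by blast
  then show ?thesis
    using S(1) by (simp add: rr_def[abs_def])
qed

subsection \<open>The Bailey chain\<close>

text \<open>The factor 1 - q^(M+1) is split as in \<open>q_binomial\<close>. After the index shift,
  the parts belonging to the same s add up to the summand for M with c raised by 1.\<close>

lemma durfee_finite:
  "(\<Sum>s\<le>M. q ^ (s * (s + c)) / (P (M - s) * P s * P (s + c))) = 1 / (P M * P (M + c))"
proof (induction M arbitrary: c)
  case (Suc M)
  define t where "t s = q ^ (s * (s + Suc c)) / (P (M - s) * P s * P (s + Suc c))" for s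
  define u where "u s = q ^ (s * (s + c)) / (P (Suc M - s) * P s * P (s + c))" for s
  have nz: "1 - q ^ Suc n \<noteq> 0" for n
    using q_power_neq_1[of "Suc n"] by (simp del: power_Suc)
  have split: "(1 - q ^ Suc M) * u j = (1 - q ^ j) * u j + q ^ j * (1 - q ^ (Suc M - j)) * u j"
    if "j \<le> Suc M" for j
  proof -
    have "q ^ Suc M = q ^ j * q ^ (Suc M - j)"
      using that by (metis le_add_diff_inverse power_add)
    then show ?thesis by (simp add: algebra_simps)
  qed
  have A: "(1 - q ^ Suc s) * u (Suc s) = q ^ (s + Suc c) * q ^ s * q ^ (s * (s + c)) / (P (M - s) * P s * P (s + Suc c))" for s
  proof -
    have "u (Suc s) = q ^ (Suc s * (Suc s + c)) / (P (M - s) * (P s * (1 - q ^ Suc s)) * P (s + Suc c))"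
      by (simp add: u_def P_Suc)
    moreover have "q ^ (Suc s * (Suc s + c)) = q ^ (s + Suc c) * q ^ s * q ^ (s * (s + c))"
      by (simp add: power_add[symmetric] add_ac del: power_Suc)
    ultimately show ?thesis
      using nz[of s] by (simp add: mult_ac del: power_Suc mult_Suc)
  qed
  have B: "q ^ s * (1 - q ^ (Suc M - s)) * u s =
      (1 - q ^ (s + Suc c)) * q ^ s * q ^ (s * (s + c)) / (P (M - s) * P s * P (s + Suc c))" if "s \<le> M" for s
  proof -
    have "u s = q ^ (s * (s + c)) / (P (M - s) * (1 - q ^ (Suc M - s)) * P s * P (s + c))"
      using that by (simp add: u_def P_Suc Suc_diff_le)
    moreover have "P (s + Suc c) = P (s + c) * (1 - q ^ (s + Suc c))"
      by (simp add: P_Suc)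
    ultimately show ?thesis
      using nz[of "M - s"] nz[of "s + c"] that by (simp add: Suc_diff_le mult_ac del: power_Suc)
  qed
  have AB: "(1 - q ^ Suc s) * u (Suc s) + q ^ s * (1 - q ^ (Suc M - s)) * u s = t s" if "s \<le> M" for s
    unfolding A B[OF that] add_divide_distrib[symmetric]
    by (simp add: t_def power_add algebra_simps del: power_Suc)
  have "(1 - q ^ Suc M) * (\<Sum>s\<le>Suc M. u s) =
      (\<Sum>s\<le>Suc M. (1 - q ^ s) * u s) + (\<Sum>s\<le>Suc M. q ^ s * (1 - q ^ (Suc M - s)) * u s)"
    using split by (simp add: sum_distrib_left flip: sum.distrib del: sum.atMost_Suc power_Suc)
  also have "(\<Sum>s\<le>Suc M. (1 - q ^ s) * u s) = (\<Sum>s\<le>M. (1 - q ^ Suc s) * u (Suc s))"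
    by (subst sum.atMost_Suc_shift) (simp del: power_Suc)
  also have "(\<Sum>s\<le>Suc M. q ^ s * (1 - q ^ (Suc M - s)) * u s) = (\<Sum>s\<le>M. q ^ s * (1 - q ^ (Suc M - s)) * u s)"
    by simp
  also have "(\<Sum>s\<le>M. (1 - q ^ Suc s) * u (Suc s)) + (\<Sum>s\<le>M. q ^ s * (1 - q ^ (Suc M - s)) * u s) = (\<Sum>s\<le>M. t s)"
    by (simp add: AB flip: sum.distrib del: power_Suc)
  also have "(\<Sum>s\<le>M. t s) = 1 / (P M * P (M + Suc c))"
    unfolding t_def by (rule Suc.IH)
  finally have "(1 - q ^ Suc M) * (\<Sum>s\<le>Suc M. u s) = 1 / (P M * P (M + Suc c))" .
  then have "(\<Sum>s\<le>Suc M. u s) = 1 / (P M * P (M + Suc c)) / (1 - q ^ Suc M)"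
    using nz[of M] by (metis nonzero_mult_div_cancel_left)
  then show ?case
    unfolding u_def by (simp add: P_Suc mult_ac del: power_Suc sum.atMost_Suc)
qed simp

text \<open>
  Bailey pairs relative to \<open>q\<close>, with the common factor \<open>1 - q\<close> of \<open>\<alpha>\<close> and of the denominators \<open>(q\<^sup>2;q)\<^bsub>n+L\<^esub>\<close>
  removed; \<open>e\<close> counts the iterations of Bailey's lemma starting from the unit pair.
\<close>
definition bailey_alpha :: "nat \<Rightarrow> nat \<Rightarrow> complex" where
  "bailey_alpha e L = (- 1) ^ L * q ^ (e * (L * (L + 1)) + (L choose 2)) * (1 - q ^ (2 * L + 1))"

definition bailey_beta :: "nat \<Rightarrow> nat \<Rightarrow> complex" where
  "bailey_beta e n = (\<Sum>L\<le>n. bailey_alpha e L / (P (n - L) * P (n + L + 1)))"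

text \<open>This orthogonality identifies the pair with \<open>e = 0\<close> as the unit Bailey
  pair, where the iteration starts.\<close>

lemma bailey_beta_0: "bailey_beta 0 n = (if n = 0 then 1 else 0)"
proof (cases "n = 0")
  case True
  then show ?thesis
    using q_power_neq_1[of 1] by (simp add: bailey_beta_def bailey_alpha_def P_Suc numeral_2_eq_2)
next
  case False
  \<comment> \<open>\<open>1 - q ^ n\<close> times the summand telescopes through \<open>t\<close>\<close>
  define t where "t L = (- 1) ^ L * q ^ (L choose 2) * (1 - q ^ L) / (P (n - L) * P (n + L))" for L
  define b where "b L = bailey_alpha 0 L / (P (n - L) * P (n + L + 1))" for L
  have nz: "1 - q ^ Suc n \<noteq> 0" for n
    using q_power_neq_1[of "Suc n"] by (simp del: power_Suc)
  have step: "(1 - q ^ n) * b L = t L - t (Suc L)" if L: "L < n" for L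
  proof -
    obtain m where m: "n = Suc (L + m)"
      using L less_iff_Suc_add by auto
    define c where "c = (- 1) ^ L * q ^ (L choose 2) / (P (n - L) * P (n + L + 1))"
    have bL: "b L = c * (1 - q ^ (2 * L + 1))"
      by (simp add: b_def c_def bailey_alpha_def)
    have tL: "t L = c * ((1 - q ^ L) * (1 - q ^ (n + L + 1)))"
      using nz[of "n + L"] by (simp add: t_def c_def P_Suc del: power_Suc)
    have tS: "t (Suc L) = - c * (q ^ L * (1 - q ^ Suc L) * (1 - q ^ (n - L)))"
    proof -
      have "P (n - L) = P (n - Suc L) * (1 - q ^ (n - L))" "1 - q ^ (n - L) \<noteq> 0"
        using nz[of m] by (simp_all add: m P_Suc Suc_diff_le del: power_Suc)
      then show ?thesis
        unfolding t_def c_def by (simp add: choose_two_Suc power_add mult_ac)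
    qed
    have qn: "q ^ n = q ^ L * q ^ (n - L)"
      using L by (simp flip: power_add)
    have "(1 - q ^ n) * b L - (t L - t (Suc L)) = 0"
      unfolding bL tL tS by (simp add: power_add mult_2 qn) (simp add: algebra_simps)
    then show ?thesis by simp
  qed
  have part: "(1 - q ^ n) * (\<Sum>L<M. b L) = - t M" if "M \<le> n" for M
    using that
  proof (induction M)
    case 0
    then show ?case by (simp add: t_def)
  next
    case (Suc M)
    then show ?case using step[of M] by (simp add: distrib_left)
  qed
  \<comment> \<open>The summand L = n is treated apart, since \<open>n - Suc L\<close> would be
    truncated there; it cancels the boundary term of the telescoping sum.\<close>
  have "b n = (- 1) ^ n * q ^ (n choose 2) / P (2 * n)"
    using nz[of "2 * n"] by (simp add: b_def bailey_alpha_def P_Suc mult_2[symmetric] del: power_Suc)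
  then have "t n = (1 - q ^ n) * b n"
    by (simp add: t_def mult_2)
  then have "(1 - q ^ n) * (\<Sum>L<Suc n. b L) = 0"
    using part[of n] by (simp add: distrib_left)
  moreover have "1 - q ^ n \<noteq> 0"
    using q_power_neq_1[of n] False by simp
  ultimately show ?thesis
    using False by (simp add: bailey_beta_def b_def lessThan_Suc_atMost del: sum.lessThan_Suc)
qed

text \<open>After exchanging the sums, r = L + s turns the inner sum into
  \<open>durfee_finite\<close> with c = 2L + 1. The factor q^(L(L+1)) that it leaves raises
  \<open>e\<close> by one.\<close>

lemma bailey_beta_Suc:
  "bailey_beta (Suc e) n = (\<Sum>r\<le>n. q ^ (r\<^sup>2 + r) / P (n - r) * bailey_beta e r)"
proof -
  define w where "w r L = q ^ (r\<^sup>2 + r) / (P (n - r) * P (r - L) * P (r + L + 1))" for r L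
  have inner: "(\<Sum>r\<in>{L..n}. w r L) = q ^ (L * (L + 1)) / (P (n - L) * P (n + L + 1))" if L: "L \<le> n" for L
  proof -
    have "(\<Sum>r\<in>{L..n}. w r L) = (\<Sum>s\<le>n - L. w (L + s) L)"
      by (rule sum.reindex_bij_witness[of _ "\<lambda>s. L + s" "\<lambda>r. r - L"]) (use L in auto)
    also have "\<dots> = (\<Sum>s\<le>n - L. q ^ (L * (L + 1)) *
        (q ^ (s * (s + (2 * L + 1))) / (P (n - L - s) * P s * P (s + (2 * L + 1)))))"
    proof (rule sum.cong[OF refl])
      fix s
      have "(L + s)\<^sup>2 + (L + s) = L * (L + 1) + s * (s + (2 * L + 1))"
        by (simp add: power2_eq_square algebra_simps)
      moreover have "L + s + L + 1 = s + (2 * L + 1)" by simp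
      ultimately show "w (L + s) L = q ^ (L * (L + 1)) *
        (q ^ (s * (s + (2 * L + 1))) / (P (n - L - s) * P s * P (s + (2 * L + 1))))"
        unfolding w_def by (simp only: power_add[of q "L * (L + 1)"]) (simp add: diff_diff_left)
    qed
    also have "\<dots> = q ^ (L * (L + 1)) * (1 / (P (n - L) * P (n - L + (2 * L + 1))))"
      by (simp only: durfee_finite flip: sum_distrib_left)
    also have "n - L + (2 * L + 1) = n + L + 1"
      using L by simp
    finally show ?thesis by simp
  qed
  have "(\<Sum>r\<le>n. q ^ (r\<^sup>2 + r) / P (n - r) * bailey_beta e r) =
      (\<Sum>r\<le>n. \<Sum>L\<le>r. bailey_alpha e L * w r L)"
    by (simp add: bailey_beta_def sum_distrib_left w_def mult_ac)
  also have "\<dots> = (\<Sum>L\<le>n. \<Sum>r\<in>{L..n}. bailey_alpha e L * w r L)"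
    unfolding sum.Sigma[OF finite_atMost ballI[OF finite_atMost]] sum.Sigma[OF finite_atMost ballI[OF finite_atLeastAtMost]]
    by (rule sum.reindex_bij_witness[of _ "\<lambda>(L, r). (r, L)" "\<lambda>(r, L). (L, r)"]) auto
  also have "\<dots> = (\<Sum>L\<le>n. bailey_alpha e L * (q ^ (L * (L + 1)) / (P (n - L) * P (n + L + 1))))"
    by (intro sum.cong refl) (simp only: inner atMost_iff flip: sum_distrib_left)
  also have "\<dots> = bailey_beta (Suc e) n"
    unfolding bailey_beta_def bailey_alpha_def by (intro sum.cong refl) (simp add: power_add mult_ac)
  finally show ?thesis by simp
qed

lemma bailey_beta_1: "bailey_beta (Suc 0) n = 1 / P n"
proof -
  have "bailey_beta (Suc 0) n = (\<Sum>r\<le>n. if r = 0 then 1 / P n else 0)"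
    unfolding bailey_beta_Suc by (intro sum.cong) (auto simp: bailey_beta_0)
  then show ?thesis by simp
qed

section \<open>The inner multisum as an iterated Bailey chain\<close>

lemma qpoch_q_nat: "qpoch q q (int n) = P n"
proof -
  have "qpoch_inf (q ^ Suc n) q \<noteq> 0"
    using qpoch_inf_q_eq[of n] qpoch_inf_q_nz by auto
  then show ?thesis
    using qpoch_inf_q_eq[of n] by (simp add: qpoch_def)
qed

lemma recip_qpoch_nat: "recip_qpoch q (int n) = 1 / P n"
  by (simp add: recip_qpoch_def qpoch_q_nat)

lemma recip_qpoch_diff: "recip_qpoch q (int n - int m) = (if m \<le> n then 1 / P (n - m) else 0)"
  using recip_qpoch_nat[of "n - m"] by (auto simp: recip_qpoch_def of_nat_diff)

text \<open>
  Starting the tuples at an arbitrary index \<open>j\<close> lets the induction remove \<open>n\<^sub>j\<close> without renumbering.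
\<close>
definition multisum_term :: "nat \<Rightarrow> nat \<Rightarrow> nat \<Rightarrow> (nat \<Rightarrow> nat) \<Rightarrow> complex" where
  "multisum_term k j n \<nu> =
     q ^ ((\<Sum>i\<in>{j..<k}. (tail_sum k \<nu> i)\<^sup>2) + (\<Sum>i\<in>{j..<k}. tail_sum k \<nu> i))
     * recip_qpoch q (int n - int (tail_sum k \<nu> j))
     * (\<Prod>i\<in>{j..<k}. recip_qpoch q (int (\<nu> i)))"

text \<open>Since n_j = r - N_(j+1) with r = N_j, the factor 1/(q;q)_(n_j) becomes the leading
  factor of the shorter multisum with n replaced by r.\<close>

lemma multisum_term_Suc:
  assumes "j < k" "tail_sum k \<nu> j = r" "r \<le> n"
  shows "multisum_term k j n \<nu> =
    q ^ (r\<^sup>2 + r) / P (n - r) * multisum_term k (Suc j) r (\<nu>(j := undefined))"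
proof -
  let ?\<nu> = "\<nu>(j := undefined)"
  have tail: "tail_sum k ?\<nu> i = tail_sum k \<nu> i" if "i \<in> {Suc j..<k}" for i
    using that by (intro tail_sum_upd) auto
  have head: "int (\<nu> j) = int r - int (tail_sum k ?\<nu> (Suc j))"
    using tail_sum_head[OF assms(1), of \<nu>] assms(2) by (simp add: tail_sum_upd)
  have "(\<Sum>i\<in>{j..<k}. (tail_sum k \<nu> i)\<^sup>2) = r\<^sup>2 + (\<Sum>i\<in>{Suc j..<k}. (tail_sum k ?\<nu> i)\<^sup>2)"
    "(\<Sum>i\<in>{j..<k}. tail_sum k \<nu> i) = r + (\<Sum>i\<in>{Suc j..<k}. tail_sum k ?\<nu> i)"
    "(\<Prod>i\<in>{j..<k}. recip_qpoch q (int (\<nu> i))) =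
      recip_qpoch q (int r - int (tail_sum k ?\<nu> (Suc j))) * (\<Prod>i\<in>{Suc j..<k}. recip_qpoch q (int (?\<nu> i)))"
    using assms(1,2) tail head
    by (simp_all add: sum.atLeast_Suc_lessThan prod.atLeast_Suc_lessThan)
  then show ?thesis
    using assms(2,3) by (simp add: multisum_term_def recip_qpoch_diff[of n r] power_add mult_ac)
qed

text \<open>Grouping the tuples by the value r of N_j reproduces the recurrence
  \<open>bailey_beta_Suc\<close>; the empty tuple gives \<open>bailey_beta_1\<close>.\<close>

lemma multisum_has_sum:
  assumes "j \<le> k"
  shows "(multisum_term k j n has_sum bailey_beta (Suc (k - j)) n) ({j..<k} \<rightarrow>\<^sub>E UNIV)"
  using assms
proof (induction j arbitrary: n rule: inc_induct)
  case base
  show ?case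
    using recip_qpoch_nat[of n]
    by (simp add: multisum_term_def tail_sum_def bailey_beta_1 has_sum_finite_iff)
next
  case (step j)
  let ?X = "{j..<k} \<rightarrow>\<^sub>E (UNIV :: nat set)" and ?Y = "{Suc j..<k} \<rightarrow>\<^sub>E (UNIV :: nat set)"
  define A where "A r = {\<nu> \<in> ?X. tail_sum k \<nu> j = r}" for r
  define c where "c r = q ^ (r\<^sup>2 + r) / P (n - r)" for r
  have "(multisum_term k j n has_sum c r * bailey_beta (k - j) r) (A r)" if r: "r \<le> n" for r
  proof -
    have "((\<lambda>\<nu>. c r * multisum_term k (Suc j) r \<nu>) has_sum c r * bailey_beta (Suc (k - Suc j)) r) ?Y"
      by (rule has_sum_cmult_right[OF step.IH])
    also have "Suc (k - Suc j) = k - j"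
      using step.hyps by simp
    \<comment> \<open>Tuples with N_(j+1) > r contribute 0 by the convention for negative indices.
      Restricting to the others makes the natural subtraction that recovers n_j exact.\<close>
    also have "((\<lambda>\<nu>. c r * multisum_term k (Suc j) r \<nu>) has_sum c r * bailey_beta (k - j) r) ?Y \<longleftrightarrow>
        ((\<lambda>\<nu>. c r * multisum_term k (Suc j) r \<nu>) has_sum c r * bailey_beta (k - j) r)
          {\<nu> \<in> ?Y. tail_sum k \<nu> (Suc j) \<le> r}"
      by (rule has_sum_cong_neutral) (auto simp: multisum_term_def recip_qpoch_diff)
    also have "\<dots> \<longleftrightarrow> (multisum_term k j n has_sum c r * bailey_beta (k - j) r) (A r)"
    proof (rule sym, rule has_sum_reindex_bij_witness[of _ "\<lambda>\<nu>. \<nu>(j := r - tail_sum k \<nu> (Suc j))"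
          "\<lambda>\<nu>. \<nu>(j := undefined)"])
      fix \<nu> assume \<nu>: "\<nu> \<in> A r"
      have t: "tail_sum k (\<nu>(j := undefined)) (Suc j) = tail_sum k \<nu> (Suc j)"
        by (simp add: tail_sum_upd)
      have h: "r = \<nu> j + tail_sum k \<nu> (Suc j)"
        using tail_sum_head[OF step.hyps(2), of \<nu>] \<nu> by (simp add: A_def)
      show "(\<nu>(j := undefined))(j := r - tail_sum k (\<nu>(j := undefined)) (Suc j)) = \<nu>"
        using h unfolding t by auto
      show "\<nu>(j := undefined) \<in> {\<nu> \<in> ?Y. tail_sum k \<nu> (Suc j) \<le> r}"
        using \<nu> h t by (auto simp: A_def PiE_def extensional_def)
      show "c r * multisum_term k (Suc j) r (\<nu>(j := undefined)) = multisum_term k j n \<nu>"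
        using multisum_term_Suc[OF step.hyps(2) _ r, of \<nu>] \<nu> by (simp add: A_def c_def)
    next
      fix \<nu> assume \<nu>: "\<nu> \<in> {\<nu> \<in> ?Y. tail_sum k \<nu> (Suc j) \<le> r}"
      then have "\<nu> j = undefined"
        by (auto simp: PiE_def extensional_def)
      then show "\<nu>(j := r - tail_sum k \<nu> (Suc j), j := undefined) = \<nu>"
        by auto
      show "\<nu>(j := r - tail_sum k \<nu> (Suc j)) \<in> A r"
        using \<nu> step.hyps by (auto simp: A_def PiE_def extensional_def tail_sum_head tail_sum_upd)
    qed simp
    finally show ?thesis .
  qed
  then have "(multisum_term k j n has_sum (\<Sum>r\<le>n. c r * bailey_beta (k - j) r)) (\<Union>r\<in>{..n}. A r)"
    by (intro sum_has_sum) (auto simp: A_def)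
  also have "(\<Sum>r\<le>n. c r * bailey_beta (k - j) r) = bailey_beta (Suc (k - j)) n"
    by (simp add: c_def bailey_beta_Suc)
  \<comment> \<open>The same convention discards the tuples with N_j > n.\<close>
  also have "(multisum_term k j n has_sum bailey_beta (Suc (k - j)) n) (\<Union>r\<in>{..n}. A r) \<longleftrightarrow>
      (multisum_term k j n has_sum bailey_beta (Suc (k - j)) n) ?X"
    by (rule has_sum_cong_neutral) (auto simp: A_def multisum_term_def recip_qpoch_diff)
  finally show ?case .
qed

lemma inner_sum_eq_bailey_beta:
  assumes "k \<ge> 1"
  shows "inner_sum k q n = bailey_beta k n"
  using infsumI[OF multisum_has_sum[OF assms, of n]] assms
  by (simp add: inner_sum_def multisum_term_def[abs_def])

subsection \<open>Summation of the outer series\<close>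

lemma summable_on_norm_wing: "(\<lambda>d. norm (wing u v d)) summable_on (UNIV :: int set)"
proof (rule summable_on_int_split)
  show "(\<lambda>n. norm (wing u v (int n))) summable_on UNIV"
    using summable_on_norm_q_choose_two[of "norm u"] by (simp add: wing_def norm_mult norm_power)
  have "norm (wing u v (- int n)) = norm q ^ (n choose 2) * norm v ^ n" for n
    by (cases "n = 0") (auto simp: wing_def norm_mult norm_power)
  then show "(\<lambda>n. norm (wing u v (- int n))) summable_on UNIV"
    using summable_on_norm_q_choose_two[of "norm v"] by simp
qed

lemma summable_on_wing: "wing u v summable_on (UNIV :: int set)"
  by (rule abs_summable_summable[OF summable_on_norm_wing])

text \<open>The case z = 1 of the product expansion, where every coefficient \<open>phi\<close> is
  1.\<close>

lemma jacobi_triple_product: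
  assumes "x \<noteq> 0"
  shows "(wing x (q / x) has_sum qpoch_inf q q * qpoch_inf x q * qpoch_inf (q / x) q) (UNIV :: int set)"
  using qpoch_inf_product_has_sum[of x "q / x" 1] assms by simp

text \<open>The factor q^n (q;q)_(2n) / ((a;q)_(n+1) (q/a;q)_n) of the theorem, multiplied by
  (q,a,q/a;q)_inf to clear its poles in a.\<close>

definition weight :: "complex \<Rightarrow> nat \<Rightarrow> complex" where
  "weight a n = q ^ n * P (2 * n) *
     (qpoch_inf q q * qpoch_inf (a * q ^ (n + 1)) q * qpoch_inf (q ^ (n + 1) / a) q)"

lemma wing_shift:
  "wing (u * q ^ m) (v * q ^ m) d = wing u v d * q ^ (m * nat \<bar>d\<bar>)"
  by (simp add: wing_def power_mult_distrib power_mult[symmetric])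

text \<open>Each weight is expanded in powers of a with z = q^(2L+2m+1). For fixed d the sum over m
  is \<open>phi_sum\<close>, whose value does not depend on d, so it factors out of the bilateral
  series.\<close>

lemma weight_has_sum:
  assumes a: "a \<noteq> 0"
  defines "T \<equiv> \<lambda>L. \<Sum>\<^sub>\<infinity>d. wing (a * q ^ (L + 1)) (q ^ (L + 1) / a) d"
  shows "((\<lambda>m. weight a (L + m) / (P m * P (m + 2 * L + 1))) has_sum
      q ^ L / (1 - q ^ (2 * L + 1)) * T L) UNIV"
proof -
  define w where "w = wing (a * q ^ (L + 1)) (q ^ (L + 1) / a)"
  define c where "c m = q ^ (L + m) * P (2 * L + 2 * m) / (P m * P (m + 2 * L + 1))" for m
  define z where "z m = q ^ (2 * L + 2 * m + 1)" for m
  define h where "h m d = c m * (w d * q ^ (m * nat \<bar>d\<bar>) * phi (nat \<bar>d\<bar>) (z m))" for m d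
  define \<Phi> where "\<Phi> = (\<Sum>\<^sub>\<infinity>N. K * (exp (1 / (1 - norm q)) * norm q ^ N))"
  define B where "B = exp (norm q / (1 - norm q))"
  have wt: "(wing (a * q ^ (L + 1)) (q ^ (L + 1) / a) has_sum T L) UNIV"
    unfolding T_def by (intro has_sum_infsum summable_on_wing)
  obtain S where S: "((\<lambda>m. weight a (L + m) / (P m * P (m + 2 * L + 1))) has_sum S) UNIV"
    "((\<lambda>d. w d * (q ^ L / (1 - q ^ (2 * L + 1)))) has_sum S) UNIV"
  proof (rule has_sum_exchange)
    show "(\<lambda>(m, d). h m d) summable_on UNIV \<times> UNIV"
    proof (rule summable_on_dominated_product)
      show "(\<lambda>m. K * (K * B) * norm q ^ m) summable_on (UNIV :: nat set)"
        by (intro summable_on_cmult_right summable_on_norm_q_power)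
      show "(\<lambda>d. norm (w d) * \<Phi>) summable_on UNIV"
        unfolding w_def by (intro summable_on_cmult_left summable_on_norm_wing)
      fix m :: nat and d :: int
      have "norm (c m) \<le> K * (K * B) * norm q ^ m"
      proof -
        have "norm (P (2 * L + 2 * m) / P m / P (m + 2 * L + 1)) \<le> K * (K * B)"
          unfolding B_def by (intro order.trans[OF norm_divide_P_le] mult_left_mono K_nonneg norm_qfac_le)
        moreover have "norm (q ^ L) * norm q ^ m \<le> 1 * norm q ^ m"
          by (intro mult_right_mono norm_q_power_le) auto
        ultimately have "norm (P (2 * L + 2 * m) / P m / P (m + 2 * L + 1)) * (norm (q ^ L) * norm q ^ m)
            \<le> K * (K * B) * (1 * norm q ^ m)"
          by (rule mult_mono) (use K_nonneg in \<open>auto simp: B_def\<close>)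
        then show ?thesis
          by (simp add: c_def norm_mult norm_divide norm_power power_add mult_ac)
      qed
      moreover have "norm (w d * q ^ (m * nat \<bar>d\<bar>) * phi (nat \<bar>d\<bar>) (z m)) \<le> norm (w d) * 1 * \<Phi>"
        unfolding norm_mult \<Phi>_def z_def
        by (intro mult_mono mult_left_mono norm_q_power_le norm_phi_le) auto
      ultimately have "norm (h m d) \<le> (K * (K * B) * norm q ^ m) * (norm (w d) * 1 * \<Phi>)"
        unfolding h_def norm_mult[of "c m"] using K_nonneg by (intro mult_mono) (auto simp: B_def)
      then show "norm (case (m, d) of (m, d) \<Rightarrow> h m d) \<le> K * (K * B) * norm q ^ m * (norm (w d) * \<Phi>)"
        by simp
    qed auto
    show "(h m has_sum weight a (L + m) / (P m * P (m + 2 * L + 1))) UNIV" for m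
    proof -
      have w: "w d * q ^ (m * nat \<bar>d\<bar>) = wing (a * q ^ (L + m + 1)) (q ^ (L + m + 1) / a) d" for d
        unfolding w_def wing_shift[symmetric] by (simp add: power_add mult_ac)
      have "a * q ^ (L + m + 1) * (q ^ (L + m + 1) / a) = z m * q"
        using a by (simp add: z_def mult_2 power_add)
      from has_sum_cmult_right[OF qpoch_inf_product_has_sum[OF this], of "c m"]
      have "(h m has_sum c m * (qpoch_inf q q * qpoch_inf (a * q ^ (L + m + 1)) q * qpoch_inf (q ^ (L + m + 1) / a) q)) UNIV"
        unfolding h_def w .
      moreover have "2 * L + 2 * m = 2 * (L + m)" by simp
      then have "c m * (qpoch_inf q q * qpoch_inf (a * q ^ (L + m + 1)) q * qpoch_inf (q ^ (L + m + 1) / a) q) =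
          weight a (L + m) / (P m * P (m + 2 * L + 1))"
        unfolding c_def weight_def by simp
      ultimately show ?thesis by simp
    qed
    show "((\<lambda>m. h m d) has_sum w d * (q ^ L / (1 - q ^ (2 * L + 1)))) UNIV" for d
    proof -
      have "h m d = w d * q ^ L * (P (2 * L + 2 * m) / (P m * P (m + 2 * L + 1)) *
          q ^ (m * (nat \<bar>d\<bar> + 1)) * phi (nat \<bar>d\<bar>) (q ^ (2 * L + 2 * m + 1)))" for m
        by (simp add: h_def c_def z_def power_add)
      then show ?thesis
        using has_sum_cmult_right[OF phi_sum[of "2 * L" "nat \<bar>d\<bar>"], of "w d * q ^ L"]
        by simp
    qed
  qed
  have "((\<lambda>d. w d * (q ^ L / (1 - q ^ (2 * L + 1)))) has_sum T L * (q ^ L / (1 - q ^ (2 * L + 1)))) UNIV"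
    unfolding w_def by (rule has_sum_cmult_left[OF wt])
  then have "S = T L * (q ^ L / (1 - q ^ (2 * L + 1)))"
    using S(2) has_sum_unique by blast
  with S(1) show ?thesis by (simp add: mult.commute)
qed

lemma norm_weight_le:
  "norm (weight a n) \<le> norm q ^ n * (exp (norm q / (1 - norm q)) *
     (norm (qpoch_inf q q) * exp (norm a / (1 - norm q)) * exp (norm (1 / a) / (1 - norm q))))"
proof -
  have *: "norm (qpoch_inf (x * q ^ n) q) \<le> exp (norm x / (1 - norm q))" for x n
  proof (rule order.trans[OF norm_qpoch_inf_le])
    have "norm x * norm (q ^ n) \<le> norm x * 1"
      by (intro mult_left_mono norm_q_power_le) auto
    then show "exp (norm (x * q ^ n) / (1 - norm q)) \<le> exp (norm x / (1 - norm q))"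
      using norm_q by (simp add: norm_mult divide_right_mono)
  qed
  have "norm (qpoch_inf (q ^ (n + 1) / a) q) \<le> exp (norm (1 / a) / (1 - norm q))"
    using *[of "1 / a" "n + 1"] by simp
  then show ?thesis
    unfolding weight_def mult.assoc[of "q ^ n"] norm_mult norm_power
    by (intro mult_mono norm_qfac_le *) auto
qed

text \<open>Insert the definition of \<open>bailey_beta\<close> and put n = L + m. The factor 1 -
  q^(2L+1) of \<open>bailey_alpha\<close> cancels the denominator from
  \<open>weight_has_sum\<close>, and q^L raises \<open>L choose 2\<close> to
  \<open>Suc L choose 2\<close>.\<close>

lemma weighted_bailey_sum:
  assumes a: "a \<noteq> 0"
  defines "T \<equiv> \<lambda>L. \<Sum>\<^sub>\<infinity>d. wing (a * q ^ (L + 1)) (q ^ (L + 1) / a) d"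
  obtains S where
    "((\<lambda>n. weight a n * bailey_beta k n) has_sum S) UNIV"
    "((\<lambda>L. (- 1) ^ L * q ^ (k * (L * (L + 1)) + (Suc L choose 2)) * T L) has_sum S) UNIV"
proof -
  define C where "C = exp (norm q / (1 - norm q)) *
     (norm (qpoch_inf q q) * exp (norm a / (1 - norm q)) * exp (norm (1 / a) / (1 - norm q)))"
  define h where "h L m = bailey_alpha k L * (weight a (L + m) / (P m * P (m + 2 * L + 1)))" for L m
  define r where "r L = (- 1) ^ L * q ^ (k * (L * (L + 1)) + (Suc L choose 2)) * T L" for L
  obtain S where S: "(r has_sum S) UNIV" "((\<lambda>n. weight a n * bailey_beta k n) has_sum S) UNIV"
  proof (rule has_sum_antidiagonal)
    show "(\<lambda>(L, m). h L m) summable_on UNIV"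
    proof (rule summable_on_dominated_product)
      show "(\<lambda>L. 2 * (norm q ^ (L choose 2) * 1 ^ L)) summable_on UNIV"
        by (intro summable_on_cmult_right summable_on_norm_q_choose_two) auto
      show "(\<lambda>m. K * (K * (norm q ^ m * C))) summable_on (UNIV :: nat set)"
        by (intro summable_on_cmult_right summable_on_cmult_left summable_on_norm_q_power)
      fix L m
      have "norm (bailey_alpha k L) \<le> 2 * (norm q ^ (L choose 2) * 1 ^ L)"
      proof -
        have "norm (q ^ (k * (L * (L + 1)) + (L choose 2))) \<le> norm q ^ (L choose 2)"
          using norm_q by (simp add: norm_power power_decreasing)
        moreover have "norm (1 - q ^ (2 * L + 1)) \<le> 2"
          using norm_triangle_ineq4[of 1 "q ^ (2 * L + 1)"] norm_q_power_le[of "2 * L + 1"] by simp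
        ultimately have "norm (q ^ (k * (L * (L + 1)) + (L choose 2))) * norm (1 - q ^ (2 * L + 1)) \<le>
            norm q ^ (L choose 2) * 2"
          by (intro mult_mono) auto
        then show ?thesis
          unfolding bailey_alpha_def norm_mult by (simp add: norm_power)
      qed
      moreover have "norm (weight a (L + m) / P m / P (m + 2 * L + 1)) \<le> K * (K * (norm q ^ m * C))"
      proof -
        have "norm (weight a (L + m)) \<le> norm q ^ (L + m) * C"
          unfolding C_def by (rule norm_weight_le)
        also have "\<dots> \<le> norm q ^ m * C"
          using norm_q by (intro mult_right_mono power_decreasing) (auto simp: C_def)
        finally show ?thesis
          by (intro order.trans[OF norm_divide_P_le] mult_left_mono K_nonneg)
      qed
      ultimately have "norm (bailey_alpha k L) * norm (weight a (L + m) / P m / P (m + 2 * L + 1)) \<le>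
          2 * (norm q ^ (L choose 2) * 1 ^ L) * (K * (K * (norm q ^ m * C)))"
        by (rule mult_mono) auto
      moreover have "h L m = bailey_alpha k L * (weight a (L + m) / P m / P (m + 2 * L + 1))"
        by (simp add: h_def)
      ultimately show "norm (case (L, m) of (L, m) \<Rightarrow> h L m) \<le>
          2 * (norm q ^ (L choose 2) * 1 ^ L) * (K * (K * (norm q ^ m * C)))"
        by (simp only: prod.case norm_mult)
    qed auto
    show "(h L has_sum r L) UNIV" for L
    proof -
      have "1 - q ^ (2 * L + 1) \<noteq> 0"
        using q_power_neq_1[of "2 * L + 1"] by simp
      then have "bailey_alpha k L * (q ^ L / (1 - q ^ (2 * L + 1)) * T L) = r L"
        by (simp add: bailey_alpha_def r_def choose_two_Suc power_add mult_ac)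
      then show ?thesis
        using has_sum_cmult_right[OF weight_has_sum[OF a, of L], of "bailey_alpha k L"]
        unfolding h_def T_def by simp
    qed
    show "(\<Sum>L\<le>n. h L (n - L)) = weight a n * bailey_beta k n" for n
      unfolding bailey_beta_def sum_distrib_left
      by (intro sum.cong refl) (auto simp: h_def mult_ac add_ac)
  qed
  then show ?thesis
    by (intro that) (simp_all add: r_def[abs_def])
qed


subsection \<open>The lattice sum\<close>

text \<open>For uv = q both branches merge into one formula with integer exponents, as the residue
  computation requires.\<close>

lemma wing_powi:
  assumes "x \<noteq> 0"
  shows "wing x (q / x) d = (- 1) powi d * q powi (d * (d - 1) div 2) * x powi d"
proof (cases d rule: int_cases2)
  case (nonneg n)
  have "int n * (int n - 1) div 2 = int (n choose 2)"
    by (cases n) (auto simp: choose_two of_nat_diff zdiv_int algebra_simps)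
  then show ?thesis
    by (simp add: wing_def nonneg power_int_of_nat)
next
  case (nonpos n)
  have "- int n * (- int n - 1) = int n * (int (Suc n) - 1 + 1)"
    by (simp add: algebra_simps)
  also have "\<dots> div 2 = int (Suc n choose 2)"
    by (simp add: choose_two zdiv_int algebra_simps)
  finally have e: "- int n * (- int n - 1) div 2 = int (Suc n choose 2)" .
  have "wing x (q / x) d = (- 1) ^ n * q ^ (n choose 2) * (q / x) ^ n"
    by (cases "n = 0") (auto simp: wing_def nonpos)
  also have "\<dots> = (- 1) ^ n * q ^ (Suc n choose 2) * inverse (x ^ n)"
    by (simp add: choose_two_Suc power_add field_simps)
  finally show ?thesis
    unfolding nonpos e by (simp add: power_int_minus flip: power_inverse)
qed

text \<open>This is \<open>f L d\<close> of the overview, written as a theta term of index L + d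
  times a factor in L alone. Row sums then come directly from the triple product;
  \<open>a powi (- L)\<close> restores the exponent d.\<close>

definition lattice_term :: "nat \<Rightarrow> complex \<Rightarrow> int \<Rightarrow> int \<Rightarrow> complex" where
  "lattice_term k a L d = wing (a * q) (1 / a) (L + d) * (q powi (int k * (L * (L + 1))) * a powi (- L))"

lemma lattice_term_nonneg:
  assumes "a \<noteq> 0"
  shows "lattice_term k a (int L) (int r) =
    (- 1) ^ L * q ^ (k * (L * (L + 1)) + (Suc L choose 2)) * wing (a * q ^ (L + 1)) (q ^ (L + 1) / a) (int r)"
proof -
  have e: "int k * (int L * (int L + 1)) = int (k * (L * (L + 1)))" by (simp add: algebra_simps)
  have n: "nat (int L + int r) = L + r" by simp
  have E: "((L + r) choose 2) + (L + r) = (Suc L choose 2) + ((r choose 2) + (L + 1) * r)"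
    using choose_two_add[of L r] by (simp add: choose_two_Suc)
  have q: "q ^ ((L + r) choose 2) * q ^ (L + r) = q ^ (Suc L choose 2) * (q ^ (r choose 2) * (q ^ (L + 1)) ^ r)"
    by (simp only: E flip: power_mult power_add)
  have "lattice_term k a (int L) (int r) =
      (- 1) ^ (L + r) * (q ^ ((L + r) choose 2) * q ^ (L + r)) * a ^ r * q ^ (k * (L * (L + 1)))"
    unfolding lattice_term_def wing_def e power_int_of_nat power_int_minus using assms
    by (simp add: n power_mult_distrib) (simp add: power_add)
  then show ?thesis
    unfolding q by (simp add: wing_def power_add power_mult_distrib mult_ac)
qed

text \<open>The reflection of L to -1 - L preserves L(L+1) and reverses the parity of the index;
  hence the minus sign of this quadrant.\<close>

lemma lattice_term_neg:
  assumes "a \<noteq> 0" "r > 0"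
  shows "lattice_term k a (- 1 - int L) (- int r) =
    - ((- 1) ^ L * q ^ (k * (L * (L + 1)) + (Suc L choose 2)) * wing (a * q ^ (L + 1)) (q ^ (L + 1) / a) (- int r))"
proof -
  have e: "int k * ((- 1 - int L) * (- 1 - int L + 1)) = int (k * (L * (L + 1)))"
    by (simp add: algebra_simps)
  have n: "- 1 - int L + - int r = - int (Suc L + r)" "- (- 1 - int L) = int (Suc L)" by simp_all
  have E: "((Suc L + r) choose 2) = (Suc L choose 2) + ((r choose 2) + (L + 1) * r)"
    using choose_two_add[of "Suc L" r] by simp
  have q: "q ^ ((Suc L + r) choose 2) = q ^ (Suc L choose 2) * (q ^ (r choose 2) * (q ^ (L + 1)) ^ r)"
    by (simp only: E flip: power_mult power_add)
  have "lattice_term k a (- 1 - int L) (- int r) =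
      (- 1) ^ (Suc L + r) * q ^ ((Suc L + r) choose 2) * (1 / a) ^ (Suc L + r) *
      (q ^ (k * (L * (L + 1))) * a ^ Suc L)"
    unfolding lattice_term_def e n power_int_of_nat by (simp add: wing_def del: power_Suc of_nat_Suc)
  also have "(1 / a) ^ (Suc L + r) = (1 / a) ^ r / a ^ Suc L"
    by (simp add: power_add power_one_over field_simps)
  finally have "lattice_term k a (- 1 - int L) (- int r) =
      (- 1) ^ (Suc L + r) * q ^ ((Suc L + r) choose 2) * (1 / a) ^ r * q ^ (k * (L * (L + 1)))"
    using assms(1) by simp
  then show ?thesis
    unfolding q using assms by (simp add: wing_def power_add power_divide power_mult_distrib field_simps)
qed

text \<open>The shear M = L + d separates the variables. The factor in L decays quadratically in
  both directions because k >= 1.\<close>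

lemma summable_on_lattice_term:
  assumes a: "a \<noteq> 0" and k: "k \<ge> 1"
  shows "(\<lambda>(L, d). lattice_term k a L d) summable_on X"
proof -
  define g where "g L = q powi (int k * (L * (L + 1))) * a powi (- L)" for L :: int
  have "(\<lambda>L. norm (g L)) summable_on UNIV"
  proof (rule summable_on_int_split)
    have "norm (g (int n)) \<le> norm q ^ (n choose 2) * norm (1 / a) ^ n" for n
    proof -
      have "int k * (int n * (int n + 1)) = int (k * (n * (n + 1)))" by (simp add: algebra_simps)
      then have "norm (g (int n)) = norm q ^ (k * (n * (n + 1))) * norm (1 / a) ^ n"
        by (simp only: g_def power_int_of_nat power_int_minus norm_mult norm_power)
           (simp add: norm_inverse norm_power power_one_over norm_divide inverse_eq_divide)
      moreover have "n choose 2 \<le> k * (n * (n + 1))"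
      proof -
        have "n choose 2 \<le> 1 * (n * (n + 1))" by (simp add: square_eq_choose_two)
        also have "\<dots> \<le> k * (n * (n + 1))" using k by (intro mult_right_mono) auto
        finally show ?thesis .
      qed
      ultimately show ?thesis
        using norm_q by (simp add: mult_right_mono power_decreasing)
    qed
    then show "(\<lambda>n. norm (g (int n))) summable_on UNIV"
      by (intro summable_on_comparison_test[OF summable_on_norm_q_choose_two[of "norm (1 / a)"]]) auto
    have "norm (g (- int n)) \<le> norm q ^ (n choose 2) * norm a ^ n" for n
    proof -
      have "int n * int n = 2 * int (n choose 2) + int n"
        using square_eq_choose_two[of n] by (metis of_nat_add of_nat_mult of_nat_numeral)
      then have "int k * (- int n * (- int n + 1)) = int (k * (2 * (n choose 2)))"
        by (simp add: algebra_simps)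
      then have "norm (g (- int n)) = norm q ^ (k * (2 * (n choose 2))) * norm a ^ n"
        by (simp only: g_def power_int_of_nat minus_minus norm_mult norm_power)
      moreover have "1 * (n choose 2) \<le> k * (2 * (n choose 2))"
        using k by (intro mult_mono) auto
      ultimately show ?thesis
        using norm_q by (simp add: mult_right_mono power_decreasing)
    qed
    then show "(\<lambda>n. norm (g (- int n))) summable_on UNIV"
      by (intro summable_on_comparison_test[OF summable_on_norm_q_choose_two[of "norm a"]]) auto
  qed
  then have "(\<lambda>(L, M). g L * wing (a * q) (1 / a) M) summable_on UNIV \<times> UNIV"
    by (rule summable_on_dominated_product[OF _ summable_on_norm_wing]) (auto simp: norm_mult)
  also have "?this \<longleftrightarrow> (\<lambda>(L, d). lattice_term k a L d) summable_on UNIV"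
    by (rule summable_on_reindex_bij_witness[of _ "\<lambda>(L, d). (L, L + d)" "\<lambda>(L, M). (L, M - L)"])
       (auto simp: lattice_term_def g_def)
  finally show ?thesis
    by (rule summable_on_subset) auto
qed

text \<open>For fixed L the row is a multiple of the triple product at aq, and a (aq;q)_inf
  (1/a;q)_inf = - (a;q)_inf (q/a;q)_inf.\<close>

lemma lattice_row_has_sum:
  assumes a: "a \<noteq> 0" "a \<noteq> 1"
  shows "((\<lambda>d. lattice_term k a (- 1 - int n) d) has_sum
    - (qpoch_inf q q * qpoch_inf a q * qpoch_inf (q / a) q * (a ^ n * q ^ (k * n * (n + 1))))) UNIV"
proof -
  have e: "int k * ((- 1 - int n) * (- 1 - int n + 1)) = int (k * n * (n + 1))"
    by (simp add: algebra_simps)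
  have n: "- (- 1 - int n) = int (Suc n)" by simp
  have 1: "qpoch_inf a q = (1 - a) * qpoch_inf (a * q) q"
    using qpoch_inf_split[of a 1] by (simp add: qfac_Suc)
  have 2: "qpoch_inf (1 / a) q = (1 - 1 / a) * qpoch_inf (q / a) q"
    using qpoch_inf_split[of "1 / a" 1] by (simp add: qfac_Suc)
  have theta: "qpoch_inf q q * qpoch_inf (a * q) q * qpoch_inf (1 / a) q * a =
      - (qpoch_inf q q * qpoch_inf a q * qpoch_inf (q / a) q)"
    unfolding 1 2 using a by (simp add: field_simps)
  have "(wing (a * q) (1 / a) has_sum
      qpoch_inf q q * qpoch_inf (a * q) q * qpoch_inf (1 / a) q) (UNIV :: int set)"
    using jacobi_triple_product[of "a * q"] a q_nz by simp
  from has_sum_cmult_left[OF this, of "q ^ (k * n * (n + 1)) * a ^ Suc n"]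
  have "((\<lambda>M. wing (a * q) (1 / a) M * (q ^ (k * n * (n + 1)) * a ^ Suc n)) has_sum
      qpoch_inf q q * qpoch_inf (a * q) q * qpoch_inf (1 / a) q * a * (a ^ n * q ^ (k * n * (n + 1)))) UNIV"
    by (simp add: mult_ac)
  also have "?this \<longleftrightarrow> ((\<lambda>d. lattice_term k a (- 1 - int n) d) has_sum
      qpoch_inf q q * qpoch_inf (a * q) q * qpoch_inf (1 / a) q * a * (a ^ n * q ^ (k * n * (n + 1)))) UNIV"
    unfolding lattice_term_def e n power_int_of_nat
    by (rule has_sum_reindex_bij_witness[of _ "\<lambda>d. - 1 - int n + d" "\<lambda>M. M - (- 1 - int n)"]) auto
  finally show ?thesis
    unfolding theta by simp
qed

lemma nome_power: "m > 0 \<Longrightarrow> nome (q ^ m)"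
  by (rule nome.intro) (use q_nz norm_q power_less_one_iff[of "norm q" m] in \<open>simp_all add: norm_power\<close>)

text \<open>
  The shift of the summation variable by \<open>n + 1\<close> is what turns the exponent for \<open>d = \<kappa> n + i\<close>
  into that of the triple product with base \<open>q^\<kappa>\<close> at \<open>q^i\<close>.
\<close>
lemma lattice_term_residue:
  assumes a: "a \<noteq> 0" and \<kappa>: "\<kappa> = 2 * k + 1"
  shows "lattice_term k a (j - 1 - int n) (int (\<kappa> * n + i)) =
    (- 1) ^ (i + 1) * a ^ i * q ^ (i choose 2) * (a ^ (\<kappa> * n) * q ^ (k * n * (\<kappa> * n + 2 * i))) *
    nome.wing (q ^ \<kappa>) (q ^ i) (q ^ \<kappa> / q ^ i) j"
proof -
  interpret Q: nome "q ^ \<kappa>"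
    using \<kappa> by (intro nome_power) simp
  define L where "L = j - 1 - int n"
  define M where "M = L + int (\<kappa> * n + i)"
  have M: "M = j - 1 + int i + 2 * (int k * int n)"
    by (simp add: M_def L_def \<kappa> algebra_simps)
  have div2: "2 * (z * (z - 1) div 2) = z * (z - 1)" for z :: int
    by simp
  have i: "2 * int (i choose 2) = int i * int i - int i"
    using arg_cong[OF square_eq_choose_two[of i], of int] by simp
  have expo: "M * (M - 1) div 2 + M + int k * (L * (L + 1)) =
      int (i choose 2) + int (k * n * (\<kappa> * n + 2 * i)) + int \<kappa> * (j * (j - 1) div 2) + int i * j"
  proof -
    \<comment> \<open>Doubling clears the divisions by 2, which are exact on products of consecutive
      integers.\<close>
    have "2 * (M * (M - 1) div 2 + M + int k * (L * (L + 1))) =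
      M * (M - 1) + 2 * M + 2 * (int k * (L * (L + 1)))"
      using div2[of M] by simp
    also have "\<dots> = (int i * int i - int i) + 2 * int (k * n * (\<kappa> * n + 2 * i)) + int \<kappa> * (j * (j - 1)) + 2 * (int i * j)"
      unfolding M L_def \<kappa> by (simp add: algebra_simps)
    also have "\<dots> = 2 * (int (i choose 2) + int (k * n * (\<kappa> * n + 2 * i)) + int \<kappa> * (j * (j - 1) div 2) + int i * j)"
      using div2[of j] i by (simp add: algebra_simps)
    finally show ?thesis by simp
  qed
  \<comment> \<open>Here M differs from j - 1 + i by an even number.\<close>
  have sgn: "(- 1 :: complex) powi M = (- 1) ^ (i + 1) * (- 1) powi j"
    by (simp add: M power_int_minus_one_minus power_int_add power_int_diff power_int_mult)
  have "wing (a * q) (1 / a) M = (- 1) powi M * q powi (M * (M - 1) div 2) * (a * q) powi M"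
    using wing_powi[of "a * q" M] a q_nz by simp
  moreover have "lattice_term k a L (int (\<kappa> * n + i)) =
      wing (a * q) (1 / a) M * (q powi (int k * (L * (L + 1))) * a powi (- L))"
    by (simp only: lattice_term_def M_def)
  ultimately have "lattice_term k a L (int (\<kappa> * n + i)) =
      (- 1) powi M * (q powi (M * (M - 1) div 2) * q powi M * q powi (int k * (L * (L + 1)))) * (a powi M * a powi (- L))"
    by (simp only: power_int_mult_distrib mult_ac)
  also have "a powi M * a powi (- L) = a ^ (\<kappa> * n + i)"
  proof -
    have "M + - L = int (\<kappa> * n + i)"
      by (simp add: M_def)
    moreover have "a powi (M + - L) = a powi M * a powi (- L)"
      using a by (intro power_int_add) auto
    ultimately show ?thesis
      by (metis power_int_of_nat)
  qed
  also have "q powi (M * (M - 1) div 2) * q powi M * q powi (int k * (L * (L + 1))) =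
      q powi (int (i choose 2) + int (k * n * (\<kappa> * n + 2 * i)) + int \<kappa> * (j * (j - 1) div 2) + int i * j)"
    unfolding expo[symmetric] using q_nz by (simp add: power_int_add)
  also have "\<dots> = q ^ (i choose 2) * q ^ (k * n * (\<kappa> * n + 2 * i)) * ((q ^ \<kappa>) powi (j * (j - 1) div 2) * (q ^ i) powi j)"
    using q_nz by (simp add: power_int_add power_int_mult power_int_of_nat del: of_nat_mult of_nat_add)
  finally show ?thesis
    unfolding L_def[symmetric] sgn using q_nz
    by (simp add: Q.wing_powi power_add mult_ac)
qed

text \<open>The shift L = j - 1 - n is a bijection of the integers, after which the column is the
  triple product at q^i in the base with exponent \<kappa>.\<close>

lemma lattice_column_has_sum:
  assumes a: "a \<noteq> 0" and \<kappa>: "\<kappa> = 2 * k + 1" and i: "i < \<kappa>"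
  shows "((\<lambda>L. lattice_term k a L (int (\<kappa> * n + i))) has_sum
    (- 1) ^ (i + 1) * a ^ i * q ^ (i choose 2) * qpochs_inf [q ^ i, q ^ (\<kappa> - i), q ^ \<kappa>] (q ^ \<kappa>) *
    (a ^ (\<kappa> * n) * q ^ (k * n * (\<kappa> * n + 2 * i)))) UNIV"
proof -
  interpret Q: nome "q ^ \<kappa>"
    using \<kappa> by (intro nome_power) simp
  define c where "c = (- 1) ^ (i + 1) * a ^ i * q ^ (i choose 2) * (a ^ (\<kappa> * n) * q ^ (k * n * (\<kappa> * n + 2 * i)))"
  have "q ^ \<kappa> / q ^ i = q ^ (\<kappa> - i)"
    using q_nz i by (simp add: power_diff)
  then have "(Q.wing (q ^ i) (q ^ \<kappa> / q ^ i) has_sum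
      qpochs_inf [q ^ i, q ^ (\<kappa> - i), q ^ \<kappa>] (q ^ \<kappa>)) UNIV"
    using Q.jacobi_triple_product[of "q ^ i"] q_nz by (simp add: qpochs_inf_def mult_ac)
  from has_sum_cmult_right[OF this, of c]
  have "((\<lambda>j. lattice_term k a (j - 1 - int n) (int (\<kappa> * n + i))) has_sum
      c * qpochs_inf [q ^ i, q ^ (\<kappa> - i), q ^ \<kappa>] (q ^ \<kappa>)) UNIV"
    unfolding lattice_term_residue[OF a \<kappa>] c_def .
  also have "?this \<longleftrightarrow> ((\<lambda>L. lattice_term k a L (int (\<kappa> * n + i))) has_sum
      c * qpochs_inf [q ^ i, q ^ (\<kappa> - i), q ^ \<kappa>] (q ^ \<kappa>)) UNIV"
    by (rule has_sum_reindex_bij_witness[of _ "\<lambda>L. L + 1 + int n" "\<lambda>j. j - 1 - int n"]) auto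
  finally show ?thesis
    by (simp add: c_def mult_ac)
qed

text \<open>Exponents growing at least like \<open>n choose 2\<close> give absolute convergence, so
  the ordered series of the theorem agree with unordered sums.\<close>

lemma has_sum_suminf_q_quadratic:
  assumes "\<And>n. e n \<ge> n choose 2"
  shows "((\<lambda>n. x ^ n * q ^ e n) has_sum (\<Sum>n. x ^ n * q ^ e n)) UNIV"
proof -
  have "summable (\<lambda>n. norm (x ^ n * q ^ e n))"
  proof (rule summable_comparison_test'[OF summable_norm_q_choose_two[of "norm x"]])
    fix n
    have "norm q ^ e n \<le> norm q ^ (n choose 2)"
      using assms norm_q by (intro power_decreasing) auto
    then show "norm (norm (x ^ n * q ^ e n)) \<le> norm q ^ (n choose 2) * norm x ^ n"
      by (simp add: norm_mult norm_power mult_right_mono mult.commute[of "norm x ^ n"])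
  qed auto
  from norm_summable_imp_has_sum[OF this summable_sums[OF summable_norm_cancel[OF this]]]
  show ?thesis .
qed

text \<open>Sum over L first and write d = \<kappa> n + i by division with remainder, so that each
  residue i contributes one partial theta series.\<close>

lemma lattice_upper_half_sum:
  assumes a: "a \<noteq> 0" and \<kappa>: "\<kappa> = 2 * k + 1" and k: "k \<ge> 1"
  shows "((\<lambda>(L, d). lattice_term k a L d) has_sum
     (\<Sum>i = 1..\<kappa> - 1. (- 1) ^ (i + 1) * a ^ i * q ^ (i choose 2) *
        qpochs_inf [q ^ i, q ^ (\<kappa> - i), q ^ \<kappa>] (q ^ \<kappa>) *
        (\<Sum>n. a ^ (\<kappa> * n) * q ^ (k * n * (\<kappa> * n + 2 * i))))) (UNIV \<times> {0..})"
proof -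
  interpret Q: nome "q ^ \<kappa>"
    using \<kappa> by (intro nome_power) simp
  define c where "c i = (- 1) ^ (i + 1) * a ^ i * q ^ (i choose 2) *
    qpochs_inf [q ^ i, q ^ (\<kappa> - i), q ^ \<kappa>] (q ^ \<kappa>)" for i
  define t where "t i n = a ^ (\<kappa> * n) * q ^ (k * n * (\<kappa> * n + 2 * i))" for i n
  obtain S where S: "((\<lambda>(L, d). lattice_term k a L d) has_sum S) (UNIV \<times> {0..})"
    using summable_on_lattice_term[OF a k] by (auto simp: summable_on_def)
  then have "((\<lambda>(d, L). lattice_term k a L d) has_sum S) ({0..} \<times> UNIV)"
    by (subst (asm) has_sum_swap) simp
  also have "?this \<longleftrightarrow> ((\<lambda>(r, L). lattice_term k a L (int r)) has_sum S) (UNIV \<times> UNIV)"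
    by (rule has_sum_reindex_bij_witness[of _ "\<lambda>(r, L). (int r, L)" "\<lambda>(d, L). (nat d, L)"]) auto
  also have "\<dots> \<longleftrightarrow> ((\<lambda>((i, n), L). lattice_term k a L (int (\<kappa> * n + i))) has_sum S) (({..<\<kappa>} \<times> UNIV) \<times> UNIV)"
  proof -
    have "\<kappa> > 0" using \<kappa> by simp
    then show ?thesis
      by (intro has_sum_reindex_bij_witness[of _ "\<lambda>((i, n), L). (\<kappa> * n + i, L)"
          "\<lambda>(r, L). ((r mod \<kappa>, r div \<kappa>), L)"]) (auto simp del: of_nat_add of_nat_mult)
  qed
  finally have "((\<lambda>(i, n). c i * t i n) has_sum S) ({..<\<kappa>} \<times> UNIV)"
    by (rule has_sum_SigmaD) (use lattice_column_has_sum[OF a \<kappa>] in \<open>auto simp: c_def t_def\<close>)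
  then have "((\<lambda>i. c i * suminf (t i)) has_sum S) {..<\<kappa>}"
  proof (rule has_sum_SigmaD)
    fix i
    have "((\<lambda>n. (a ^ \<kappa>) ^ n * q ^ (k * n * (\<kappa> * n + 2 * i))) has_sum
        (\<Sum>n. (a ^ \<kappa>) ^ n * q ^ (k * n * (\<kappa> * n + 2 * i)))) UNIV"
    proof (rule has_sum_suminf_q_quadratic)
      fix n
      have "n choose 2 \<le> 1 * n * (1 * n + 0)"
        by (simp add: square_eq_choose_two)
      also have "\<dots> \<le> k * n * (\<kappa> * n + 2 * i)"
        using k \<kappa> by (intro mult_mono add_mono) auto
      finally show "n choose 2 \<le> k * n * (\<kappa> * n + 2 * i)" .
    qed
    then have "(t i has_sum suminf (t i)) UNIV"
      by (simp add: t_def[abs_def] power_mult)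
    then show "((\<lambda>n. case (i, n) of (i, n) \<Rightarrow> c i * t i n) has_sum c i * suminf (t i)) UNIV"
      by (simp add: has_sum_cmult_right)
  qed
  then have "S = (\<Sum>i<\<kappa>. c i * suminf (t i))"
    by (simp add: has_sum_finite_iff)
  \<comment> \<open>The residue i = 0 is split off because its entry q^0 = 1 makes the triple
    product vanish.\<close>
  also have "{..<\<kappa>} = insert 0 {1..\<kappa> - 1}"
    using \<kappa> by auto
  also have "(\<Sum>i\<in>insert 0 {1..\<kappa> - 1}. c i * suminf (t i)) = (\<Sum>i = 1..\<kappa> - 1. c i * suminf (t i))"
    by (simp add: c_def qpochs_inf_def)
  finally show ?thesis
    using S by (simp add: c_def t_def[abs_def])
qed

lemma theta_times_bailey_sum:
  assumes a: "a \<noteq> 0" "a \<noteq> 1" and \<kappa>: "\<kappa> = 2 * k + 1" and k: "k \<ge> 1"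
  shows "((\<lambda>n. weight a n * bailey_beta k n) has_sum
     (\<Sum>n. a ^ n * q ^ (k * n * (n + 1))) * (qpoch_inf q q * qpoch_inf a q * qpoch_inf (q / a) q) +
     (\<Sum>i = 1..\<kappa> - 1. (- 1) ^ (i + 1) * a ^ i * q ^ (i choose 2) *
        qpochs_inf [q ^ i, q ^ (\<kappa> - i), q ^ \<kappa>] (q ^ \<kappa>) *
        (\<Sum>n. a ^ (\<kappa> * n) * q ^ (k * n * (\<kappa> * n + 2 * i))))) UNIV"
    (is "(_ has_sum ?A * ?\<Theta> + ?R) UNIV")
proof -
  let ?f = "\<lambda>(L, d). lattice_term k a L d"
  define T where "T L d = wing (a * q ^ (L + 1)) (q ^ (L + 1) / a) d" for L d
  define c where "c L = (- 1) ^ L * q ^ (k * (L * (L + 1)) + (Suc L choose 2))" for L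
  obtain S where S: "((\<lambda>n. weight a n * bailey_beta k n) has_sum S) UNIV"
    "((\<lambda>L. c L * infsum (T L) UNIV) has_sum S) UNIV"
    using weighted_bailey_sum[OF a(1), of k] unfolding c_def T_def by blast
  \<comment> \<open>The sums \<open>s1\<close>, \<open>s2\<close> and \<open>s3\<close> run over
    three quadrants; \<open>s3\<close> is auxiliary and completes either of the other two to a half
    plane.\<close>
  obtain s1 where s1: "(?f has_sum s1) ({0..} \<times> {0..})"
    using summable_on_lattice_term[OF a(1) k] by (auto simp: summable_on_def)
  obtain s2 where s2: "(?f has_sum s2) ({..<0} \<times> {..<0})"
    using summable_on_lattice_term[OF a(1) k] by (auto simp: summable_on_def)
  obtain s3 where s3: "(?f has_sum s3) ({..<0} \<times> {0..})"
    using summable_on_lattice_term[OF a(1) k] by (auto simp: summable_on_def)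
  have "S = s1 - s2"
  proof -
    have "((\<lambda>(L, d). c L * T L d) has_sum s1) (UNIV \<times> {0..})"
    proof (subst has_sum_reindex_bij_witness[of _ "\<lambda>(L, d). (nat L, d)" "\<lambda>(L, d). (int L, d)" "{0..} \<times> {0..}" ?f])
      show "?f (case x of (L, d) \<Rightarrow> (int L, d)) = (case x of (L, d) \<Rightarrow> c L * T L d)"
        if "x \<in> UNIV \<times> {0..}" for x
        using that lattice_term_nonneg[OF a(1), of k "fst x" "nat (snd x)"]
        by (auto simp: c_def T_def)
    qed (use s1 in auto)
    moreover have "((\<lambda>(L, d). c L * T L d) has_sum - s2) (UNIV \<times> {..<0})"
    proof (subst has_sum_reindex_bij_witness[of _ "\<lambda>(L, d). (nat (- 1 - L), d)" "\<lambda>(L, d). (- 1 - int L, d)"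
          "{..<0} \<times> {..<0}" "\<lambda>x. - ?f x"])
      show "- ?f (case x of (L, d) \<Rightarrow> (- 1 - int L, d)) = (case x of (L, d) \<Rightarrow> c L * T L d)"
        if "x \<in> UNIV \<times> {..<0}" for x
        using that lattice_term_neg[OF a(1), of "nat (- snd x)" k "fst x"]
        by (auto simp: c_def T_def)
    qed (use s2 in \<open>auto simp: has_sum_uminus\<close>)
    ultimately have "((\<lambda>(L, d). c L * T L d) has_sum s1 + - s2) (UNIV \<times> {0..} \<union> UNIV \<times> {..<0})"
      by (rule has_sum_Un_disjoint) auto
    moreover have "UNIV \<times> {0..} \<union> UNIV \<times> {..<0} = (UNIV :: nat set) \<times> (UNIV :: int set)"
      by auto
    ultimately have "((\<lambda>(L, d). c L * T L d) has_sum s1 - s2) (UNIV \<times> UNIV)"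
      by simp
    then have "((\<lambda>L. c L * infsum (T L) UNIV) has_sum s1 - s2) UNIV"
    proof (rule has_sum_SigmaD)
      fix L
      have "(T L has_sum infsum (T L) UNIV) UNIV"
        unfolding T_def by (intro has_sum_infsum summable_on_wing)
      then show "((\<lambda>d. case (L, d) of (L, d) \<Rightarrow> c L * T L d) has_sum c L * infsum (T L) UNIV) UNIV"
        by (simp add: has_sum_cmult_right)
    qed
    then show ?thesis
      using S(2) has_sum_unique by blast
  qed
  moreover have "s2 + s3 = - (?A * ?\<Theta>)"
  proof -
    have "(?f has_sum s2 + s3) ({..<0} \<times> {..<0} \<union> {..<0} \<times> {0..})"
      by (rule has_sum_Un_disjoint[OF s2 s3]) auto
    moreover have "{..<0} \<times> {..<0} \<union> {..<0} \<times> {0..} = {..<0::int} \<times> (UNIV :: int set)"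
      by auto
    ultimately have "(?f has_sum s2 + s3) ({..<0} \<times> UNIV)"
      by simp
    also have "?this \<longleftrightarrow> ((\<lambda>(n, d). lattice_term k a (- 1 - int n) d) has_sum s2 + s3) (UNIV \<times> UNIV)"
      by (rule has_sum_reindex_bij_witness[of _ "\<lambda>(n, d). (- 1 - int n, d)" "\<lambda>(L, d). (nat (- 1 - L), d)"]) auto
    finally have "((\<lambda>n. - (?\<Theta> * (a ^ n * q ^ (k * n * (n + 1))))) has_sum s2 + s3) UNIV"
      by (rule has_sum_SigmaD) (use lattice_row_has_sum[OF a] in simp)
    moreover
    have "((\<lambda>n. a ^ n * q ^ (k * n * (n + 1))) has_sum ?A) UNIV"
    proof (rule has_sum_suminf_q_quadratic)
      fix n
      have "n choose 2 \<le> 1 * n * (n + 1)"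
        by (simp add: square_eq_choose_two)
      also have "\<dots> \<le> k * n * (n + 1)"
        using k by (intro mult_mono) auto
      finally show "n choose 2 \<le> k * n * (n + 1)" .
    qed
    from has_sum_cmult_right[OF this, of "?\<Theta>"] have "((\<lambda>n. - (?\<Theta> * (a ^ n * q ^ (k * n * (n + 1))))) has_sum - (?\<Theta> * ?A)) UNIV"
      by (rule has_sum_uminusI)
    ultimately have "s2 + s3 = - (?\<Theta> * ?A)"
      using has_sum_unique by blast
    then show ?thesis by (simp only: mult.commute)
  qed
  moreover have "s1 + s3 = ?R"
  proof -
    have "(?f has_sum s1 + s3) ({0..} \<times> {0..} \<union> {..<0} \<times> {0..})"
      by (rule has_sum_Un_disjoint[OF s1 s3]) auto
    moreover have "{0..} \<times> {0..} \<union> {..<0} \<times> {0..} = (UNIV :: int set) \<times> {0::int..}"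
      by auto
    ultimately have "(?f has_sum s1 + s3) (UNIV \<times> {0..})"
      by simp
    then show ?thesis
      using lattice_upper_half_sum[OF a(1) \<kappa> k] has_sum_unique by blast
  qed
  \<comment> \<open>The difference of quadrants becomes the half plane d >= 0 minus the half plane L
    < 0, both already evaluated.\<close>
  moreover have "s1 - s2 = (s1 + s3) - (s2 + s3)"
    by simp
  ultimately have "S = ?R - - (?A * ?\<Theta>)"
    by (simp only:)
  then have "S = ?A * ?\<Theta> + ?R"
    by (simp only: diff_minus_eq_add add.commute)
  with S(1) show ?thesis by simp
qed

end

section \<open>Division by the product (q,a,q/a;q)_inf\<close>

theorem theorem1p1:
  fixes q a :: complex and k \<kappa> :: nat
  assumes "0 < norm q" and "norm q < 1"
    and "a \<noteq> 0" and "a \<notin> {q powi m | m :: int. True}"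
    and "k \<ge> 1" and "\<kappa> = 2 * k + 1"
  shows "(\<lambda>n. qpoch q q (int (2 * n)) * q ^ n
              / (qpoch a q (int (n + 1)) * qpoch (q / a) q (int n))
              * inner_sum k q n)
         sums
         ((\<Sum>n. a ^ n * q ^ (k * n * (n + 1)))
          + (\<Sum>i = 1..\<kappa> - 1. (- 1) ^ (i + 1) * a ^ i * q ^ (i choose 2)
               * (qpochs_inf [q ^ i, q ^ (\<kappa> - i), q ^ \<kappa>] (q ^ \<kappa>) / qpochs_inf [q, a, q / a] q)
               * (\<Sum>n. a ^ (\<kappa> * n) * q ^ (k * n * (\<kappa> * n + 2 * i)))))"
proof -
  interpret nome q
    using assms(1,2) by unfold_locales auto
  define \<Theta> where "\<Theta> = qpoch_inf q q * qpoch_inf a q * qpoch_inf (q / a) q"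
  have powi: "a \<noteq> q powi m" for m
    using assms(4) by auto
  \<comment> \<open>The zeros of (a;q)_inf are a = q^(-j) and those of (q/a;q)_inf are a = q^(j+1),
    with j >= 0; all are excluded integer powers of q.\<close>
  have "qpoch_inf a q \<noteq> 0"
  proof (rule qpoch_inf_nz)
    fix j
    show "a * q ^ j \<noteq> 1"
      using powi[of "- int j"] q_nz by (auto simp: power_int_minus field_simps)
  qed
  moreover have "qpoch_inf (q / a) q \<noteq> 0"
  proof (rule qpoch_inf_nz)
    fix j
    show "q / a * q ^ j \<noteq> 1"
      using powi[of "int (Suc j)"] assms(3) by (auto simp: power_int_of_nat field_simps simp del: of_nat_Suc)
  qed
  ultimately have \<Theta>: "\<Theta> \<noteq> 0"
    using qpoch_inf_q_nz by (simp add: \<Theta>_def)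
  have list: "qpochs_inf [q, a, q / a] q = \<Theta>"
    by (simp add: qpochs_inf_def \<Theta>_def)
  have summand: "qpoch q q (int (2 * n)) * q ^ n / (qpoch a q (int (n + 1)) * qpoch (q / a) q (int n)) *
      inner_sum k q n = weight a n * bailey_beta k n / \<Theta>" for n
  proof -
    have "qpoch a q (int (n + 1)) = qpoch_inf a q / qpoch_inf (a * q ^ (n + 1)) q"
      unfolding qpoch_def power_int_of_nat ..
    moreover have "qpoch (q / a) q (int n) = qpoch_inf (q / a) q / qpoch_inf (q ^ (n + 1) / a) q"
      unfolding qpoch_def power_int_of_nat by simp
    ultimately show ?thesis
      unfolding qpoch_q_nat inner_sum_eq_bailey_beta[OF assms(5)] weight_def \<Theta>_def
      using qpoch_inf_q_nz by simp
  qed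
  \<comment> \<open>The exponent m = 0 in \<open>powi\<close> supplies that a is not 1.\<close>
  have "((\<lambda>n. weight a n * bailey_beta k n / \<Theta>) has_sum
     ((\<Sum>n. a ^ n * q ^ (k * n * (n + 1))) * \<Theta> +
     (\<Sum>i = 1..\<kappa> - 1. (- 1) ^ (i + 1) * a ^ i * q ^ (i choose 2) *
        qpochs_inf [q ^ i, q ^ (\<kappa> - i), q ^ \<kappa>] (q ^ \<kappa>) *
        (\<Sum>n. a ^ (\<kappa> * n) * q ^ (k * n * (\<kappa> * n + 2 * i))))) / \<Theta>) UNIV"
    unfolding \<Theta>_def using powi[of 0] assms
    by (intro has_sum_divide_const theta_times_bailey_sum) auto
  also have "((\<Sum>n. a ^ n * q ^ (k * n * (n + 1))) * \<Theta> +
     (\<Sum>i = 1..\<kappa> - 1. (- 1) ^ (i + 1) * a ^ i * q ^ (i choose 2) *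
        qpochs_inf [q ^ i, q ^ (\<kappa> - i), q ^ \<kappa>] (q ^ \<kappa>) *
        (\<Sum>n. a ^ (\<kappa> * n) * q ^ (k * n * (\<kappa> * n + 2 * i))))) / \<Theta> =
     ((\<Sum>n. a ^ n * q ^ (k * n * (n + 1)))
          + (\<Sum>i = 1..\<kappa> - 1. (- 1) ^ (i + 1) * a ^ i * q ^ (i choose 2)
               * (qpochs_inf [q ^ i, q ^ (\<kappa> - i), q ^ \<kappa>] (q ^ \<kappa>) / qpochs_inf [q, a, q / a] q)
               * (\<Sum>n. a ^ (\<kappa> * n) * q ^ (k * n * (\<kappa> * n + 2 * i)))))"
    unfolding list using \<Theta> by (simp add: add_divide_distrib sum_divide_distrib)
  finally show ?thesis
    unfolding summand by (rule has_sum_imp_sums)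
qed

end
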